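(* Let $g,n\ge 0$ be integers with $2-2g-n<0$ and let $(G,\underline{0})$ be a regular tropicalization of a smooth $n$-pointed genus $g$ Riemann surface. Then: (1) There is a stratification $$\overline{M^{\mathrm{tr}}(G,\underline{0})}=\bigsqcup_{(G',w')\preceq (G,\underline{0})}M^{\mathrm{tr}}(G',w'),$$ where the disjoint union runs over the weighted contractions $(G',w')$ of $(G,\underline{0})$ up to isomorphism of weighted graphs, and $M^{\mathrm{tr}}(G,\underline{0})$ is open and dense in $\overline{M^{\mathrm{tr}}(G,\underline{0})}$. (2) $\overline{M^{\mathrm{tr}}(G,\underline{0})}$ is compact and Hausdorff as a topological space.
   Context: Graphs. A graph $G$ is finite, with vertex set $V(G)$, edge set $E(G)$ (loops and multiple edges allowed) and a set $L(G)$ of leaves; the endpoint map $\epsilon$ sends an edge to its unordered pair of endpoints (a single vertex for a loop) and a leaf to the one vertex it is attached to. The degree of a vertex counts loops twice and leaves once. An isomorphism $G\to G'$ consists of bijections $V(G)\to V(G')$, $E(G)\to E(G')$, $L(G)\to L(G')$ compatible with the endpoint maps. A weighted graph $(G,w)$ is a graph with a function $w:V(G)\to\mathbb{Z}_{\ge 0}$; isomorphisms of weighted graphs preserve weights, and $\mathrm{Aut}(G,w)$ is the group of automorphisms. $\underline{0}$ denotes the zero weight function. Regular tropicalization. Let $S$ be a closed connected oriented surface of genus $g$ and $P\subset S$ a set of $n$ (ordered) points. A pants decomposition of $S\setminus P$ is a closed one-dimensional submanifold $A\subset S\setminus P$ such that every connected component of $S\setminus(P\cup A)$ is diffeomorphic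 to the interior of a pair of pants (a sphere with three holes). Its graph $G=G(S,P;A)$ has $V(G)=\pi_0(S\setminus (P\cup A))$, $E(G)=\pi_0(A)$, $L(G)=P$: the edge $\alpha\in\pi_0(A)$ joins the components lying on the two sides of $\alpha$ (it is a loop if these coincide), and the leaf $p\in P$ is attached to the component having $p$ as a puncture. A regular tropicalization of a smooth $n$-pointed genus $g$ Riemann surface (supported on $(S,P)$) is such a graph, regarded as the weighted graph $(G,\underline{0})$; it is connected, trivalent, of first Betti number $g$, with $n$ leaves. Weighted contractions. For $Q\subset E(G)$, $G_{/Q}$ is obtained from $G$ by removing the edges in $Q$ and identifying the endpoints of each edge in $Q$ (so $E(G_{/Q})=E(G)\setminus Q$, and leaves are kept). For $v'\in V(G_{/Q})$, its preimage $f^{-1}(v')$ under the contraction $f:G\to G_{/Q}$ is a connected component of the graph obtained from $G$ by removing the edges not in $Q$; set $w_{/Q}(v')=b_1(f^{-1}(v'))+\sum_{v\in f_V^{-1}(v')}w(v)$, where $b_1$ is the first Betti number. $(G_{/Q},w_{/Q})$ is a weighted contraction of $(G,w)$. Write $(G',w')\preceq(G,w)$ if $(G',w')$ is (isomorphic to) a weighted contraction of $(G,w)$. Moduli spaces. $\mathcal{C}(G,w)=\mathbb{R}_{>0}^{|E(G)|}$ (coordinates = edge lengths), and $M^{\mathrm{tr}}(G,w)=\mathcal{C}(G,w)/\mathrm{Aut}(G,w)$, the group acting by permuting coordinates. Let $\overline{\mathcal{C}(G,w)}=\big((\mathbb{R}_{\ge 0}\cup\{\infty\})/(0\sim\infty)\big)^{|E(G)|}\cong(\mathbb{S}^1)^{|E(G)|}$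 with the product topology. As a set it decomposes as $\bigsqcup_{Q\subset E(G)}\mathcal{C}(G_{/Q},w_{/Q})$, where $\mathcal{C}(G_{/Q},w_{/Q})$ is identified with the set of points whose coordinate is $0\,(=\infty)$ exactly at the edges in $Q$; so each point of $\overline{\mathcal{C}(G,w)}$ determines a weighted metric graph $(G_{/Q},w_{/Q},\ell)$ with positive finite edge lengths. $\overline{M^{\mathrm{tr}}(G,w)}$ (also written $\overline{\mathcal{C}(G,w)}/\mathrm{Aut}(G,w)$) is the quotient of $\overline{\mathcal{C}(G,w)}$, with the quotient topology, by the equivalence relation identifying two points whenever their weighted metric graphs are isomorphic (by an isomorphism of weighted graphs preserving edge lengths). For $(G',w')\cong(G_{/Q},w_{/Q})$, $M^{\mathrm{tr}}(G',w')$ is identified with the image of $\mathcal{C}(G_{/Q},w_{/Q})$ in $\overline{M^{\mathrm{tr}}(G,w)}$. *)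

theory Defs
  imports "HOL-Analysis.Analysis" "HOL-Homology.Homology"
begin

section \<open>Graphs with leaves, weights and contractions\<close>

text \<open>The endpoint map \<open>ends\<close> sends an edge to its unordered pair of endpoints; a loop is
  sent to a singleton.\<close>

record ('v, 'e, 'l) graph =
  verts :: "'v set"
  edges :: "'e set"
  leaves :: "'l set"
  ends :: "'e \<Rightarrow> 'v set"
  leaf_at :: "'l \<Rightarrow> 'v"

definition is_graph :: "('v, 'e, 'l) graph \<Rightarrow> bool" where
  "is_graph G \<longleftrightarrow>
     finite (verts G) \<and> finite (edges G) \<and> finite (leaves G) \<and>
     (\<forall>e\<in>edges G. ends G e \<subseteq> verts G \<and> (card (ends G e) = 1 \<or> card (ends G e) = 2)) \<and>
     (\<forall>l\<in>leaves G. leaf_at G l \<in> verts G)"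

definition is_graph_iso ::
  "('v, 'e, 'l) graph \<Rightarrow> ('v2, 'e2, 'l2) graph \<Rightarrow>
    ('v \<Rightarrow> 'v2) \<Rightarrow> ('e \<Rightarrow> 'e2) \<Rightarrow> ('l \<Rightarrow> 'l2) \<Rightarrow> bool" where
  "is_graph_iso G G' a b c \<longleftrightarrow>
     bij_betw a (verts G) (verts G') \<and>
     bij_betw b (edges G) (edges G') \<and>
     bij_betw c (leaves G) (leaves G') \<and>
     (\<forall>e\<in>edges G. ends G' (b e) = a ` ends G e) \<and>
     (\<forall>l\<in>leaves G. leaf_at G' (c l) = a (leaf_at G l))"

text \<open>A weighted graph is a pair of a graph \<open>G\<close> and a function \<open>w :: 'v \<Rightarrow> nat\<close>, of which only
  the values on \<open>verts G\<close> matter.\<close>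

definition is_weighted_iso ::
  "('v, 'e, 'l) graph \<Rightarrow> ('v \<Rightarrow> nat) \<Rightarrow> ('v2, 'e2, 'l2) graph \<Rightarrow> ('v2 \<Rightarrow> nat) \<Rightarrow>
    ('v \<Rightarrow> 'v2) \<Rightarrow> ('e \<Rightarrow> 'e2) \<Rightarrow> ('l \<Rightarrow> 'l2) \<Rightarrow> bool" where
  "is_weighted_iso G w G' w' a b c \<longleftrightarrow>
     is_graph_iso G G' a b c \<and> (\<forall>v\<in>verts G. w' (a v) = w v)"

definition weighted_isomorphic ::
  "('v, 'e, 'l) graph \<Rightarrow> ('v \<Rightarrow> nat) \<Rightarrow> ('v2, 'e2, 'l2) graph \<Rightarrow> ('v2 \<Rightarrow> nat) \<Rightarrow> bool" where
  "weighted_isomorphic G w G' w' \<longleftrightarrow> (\<exists>a b c. is_weighted_iso G w G' w' a b c)"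

definition metric_isomorphic ::
  "('v, 'e, 'l) graph \<Rightarrow> ('v \<Rightarrow> nat) \<Rightarrow> ('e \<Rightarrow> real) \<Rightarrow>
    ('v2, 'e2, 'l2) graph \<Rightarrow> ('v2 \<Rightarrow> nat) \<Rightarrow> ('e2 \<Rightarrow> real) \<Rightarrow> bool" where
  "metric_isomorphic G w len G' w' len' \<longleftrightarrow>
     (\<exists>a b c. is_weighted_iso G w G' w' a b c \<and> (\<forall>e\<in>edges G. len' (b e) = len e))"

definition Aut ::
  "('v, 'e, 'l) graph \<Rightarrow> ('v \<Rightarrow> nat) \<Rightarrow> (('v \<Rightarrow> 'v) \<times> ('e \<Rightarrow> 'e) \<times> ('l \<Rightarrow> 'l)) set" where
  "Aut G w = {(a, b, c). is_weighted_iso G w G w a b c}"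

text \<open>\<open>joined G Q\<close> relates two vertices that are connected by a path with edges in \<open>Q\<close>.\<close>

definition joined :: "('v, 'e, 'l) graph \<Rightarrow> 'e set \<Rightarrow> ('v \<times> 'v) set" where
  "joined G Q = {(u, v). \<exists>e\<in>Q. ends G e = {u, v}}\<^sup>* \<inter> (verts G \<times> verts G)"

text \<open>First Betti number as \<open>b\<^sub>0\<close> minus the Euler characteristic. The subtraction on \<open>nat\<close> never
  truncates for a graph, since a graph has at least \<open>|V| - |E|\<close> components.\<close>

definition betti1 :: "('v, 'e, 'l) graph \<Rightarrow> nat" where
  "betti1 G = card (edges G) + card (verts G // joined G (edges G)) - card (verts G)"

text \<open>The vertices of \<open>G/Q\<close> are the classes of vertices of \<open>G\<close> joined through \<open>Q\<close>, so that a
  vertex of \<open>G/Q\<close> is its own preimage under the contraction map on vertices.\<close>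

definition contract :: "('v, 'e, 'l) graph \<Rightarrow> 'e set \<Rightarrow> ('v set, 'e, 'l) graph" where
  "contract G Q =
     \<lparr> verts = verts G // joined G Q,
       edges = edges G - Q,
       leaves = leaves G,
       ends = (\<lambda>e. (\<lambda>v. joined G Q `` {v}) ` ends G e),
       leaf_at = (\<lambda>l. joined G Q `` {leaf_at G l}) \<rparr>"

definition fibre :: "('v, 'e, 'l) graph \<Rightarrow> 'e set \<Rightarrow> 'v set \<Rightarrow> ('v, 'e, 'l) graph" where
  "fibre G Q C =
     \<lparr> verts = C,
       edges = {e\<in>Q. ends G e \<subseteq> C},
       leaves = {l\<in>leaves G. leaf_at G l \<in> C},
       ends = ends G,
       leaf_at = leaf_at G \<rparr>"

definition contract_weight ::
  "('v, 'e, 'l) graph \<Rightarrow> ('v \<Rightarrow> nat) \<Rightarrow> 'e set \<Rightarrow> 'v set \<Rightarrow> nat" where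
  "contract_weight G w Q C = betti1 (fibre G Q C) + (\<Sum>v\<in>C. w v)"

definition weighted_contraction ::
  "('v2, 'e2, 'l2) graph \<Rightarrow> ('v2 \<Rightarrow> nat) \<Rightarrow> ('v, 'e, 'l) graph \<Rightarrow> ('v \<Rightarrow> nat) \<Rightarrow> bool" where
  "weighted_contraction G' w' G w \<longleftrightarrow> is_graph G' \<and>
     (\<exists>Q\<subseteq>edges G. weighted_isomorphic G' w' (contract G Q) (contract_weight G w Q))"

text \<open>A complete irredundant list of the weighted contractions of \<open>(G, w)\<close> up to isomorphism.\<close>

definition contraction_representatives ::
  "('v, 'e, 'l) graph \<Rightarrow> ('v \<Rightarrow> nat) \<Rightarrow>
    (('v2, 'e2, 'l2) graph \<times> ('v2 \<Rightarrow> nat)) set \<Rightarrow> bool" where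
  "contraction_representatives G w R \<longleftrightarrow>
     (\<forall>(G', w')\<in>R. weighted_contraction G' w' G w) \<and>
     (\<forall>Q\<subseteq>edges G. \<exists>!H. H \<in> R \<and>
        weighted_isomorphic (fst H) (snd H) (contract G Q) (contract_weight G w Q))"

section \<open>Quotient spaces and stratifications\<close>

definition quotient_topology :: "'a topology \<Rightarrow> ('a \<times> 'a) set \<Rightarrow> 'a set topology" where
  "quotient_topology X r =
     topology (\<lambda>U. U \<subseteq> topspace X // r \<and> openin X {x \<in> topspace X. r `` {x} \<in> U})"

lemma openin_quotient_topology:
  "openin (quotient_topology X r) U \<longleftrightarrow>
     U \<subseteq> topspace X // r \<and> openin X {x \<in> topspace X. r `` {x} \<in> U}"
proof -
  have 1: "{x \<in> topspace X. r `` {x} \<in> U \<inter> V} =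
      {x \<in> topspace X. r `` {x} \<in> U} \<inter> {x \<in> topspace X. r `` {x} \<in> V}" for U V
    by auto
  have 2: "{x \<in> topspace X. r `` {x} \<in> \<Union>K} = (\<Union>U\<in>K. {x \<in> topspace X. r `` {x} \<in> U})" for K
    by auto
  have "istopology (\<lambda>U. U \<subseteq> topspace X // r \<and> openin X {x \<in> topspace X. r `` {x} \<in> U})"
    unfolding istopology_def 1 2 by (auto intro!: openin_Union)
  then show ?thesis
    by (simp add: quotient_topology_def topology_inverse')
qed

lemma topspace_quotient_topology [simp]:
  "topspace (quotient_topology X r) = topspace X // r"
proof -
  have "{x \<in> topspace X. r `` {x} \<in> topspace X // r} = topspace X"
    by (auto simp: quotient_def)
  then have "openin (quotient_topology X r) (topspace X // r)"
    by (simp add: openin_quotient_topology)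
  then show ?thesis
    by (metis openin_quotient_topology openin_subset openin_topspace subset_antisym)
qed

lemma quotient_map_quotient_topology:
  "quotient_map X (quotient_topology X r) (\<lambda>x. r `` {x})"
  by (auto simp: quotient_map_def openin_quotient_topology quotient_def)

text \<open>A finite partition into nonempty locally closed strata such that every stratum meeting the
  closure of another one is contained in it (frontier condition).\<close>

definition stratification :: "'a topology \<Rightarrow> 'i set \<Rightarrow> ('i \<Rightarrow> 'a set) \<Rightarrow> bool" where
  "stratification X I T \<longleftrightarrow>
     finite I \<and>
     topspace X = (\<Union>i\<in>I. T i) \<and>
     disjoint_family_on T I \<and>
     (\<forall>i\<in>I. T i \<noteq> {}) \<and>
     (\<forall>i\<in>I. \<exists>U C. openin X U \<and> closedin X C \<and> T i = U \<inter> C) \<and>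
     (\<forall>i\<in>I. \<forall>j\<in>I. T i \<inter> X closure_of T j \<noteq> {} \<longrightarrow> T i \<subseteq> X closure_of T j)"

section \<open>Moduli spaces of tropical curves\<close>

definition cone :: "('v, 'e, 'l) graph \<Rightarrow> ('e \<Rightarrow> real) topology" where
  "cone G = product_topology (\<lambda>_. top_of_set {0<..}) (edges G)"

definition aut_orbit_rel ::
  "('v, 'e, 'l) graph \<Rightarrow> ('v \<Rightarrow> nat) \<Rightarrow> (('e \<Rightarrow> real) \<times> ('e \<Rightarrow> real)) set" where
  "aut_orbit_rel G w = {(x, y). x \<in> topspace (cone G) \<and> y \<in> topspace (cone G) \<and>
     (\<exists>(a, b, c)\<in>Aut G w. \<forall>e\<in>edges G. y (b e) = x e)}"

definition Mtr :: "('v, 'e, 'l) graph \<Rightarrow> ('v \<Rightarrow> nat) \<Rightarrow> ('e \<Rightarrow> real) set topology" where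
  "Mtr G w = quotient_topology (cone G) (aut_orbit_rel G w)"

text \<open>\<open>[0,\<infinity>]/(0 \<sim> \<infinity>)\<close>: its points are the class \<open>{0, \<infinity>}\<close> and the singletons \<open>{t}\<close>
  with \<open>0 < t < \<infinity>\<close>.\<close>

definition closed_ray :: "ennreal set topology" where
  "closed_ray = quotient_topology euclidean {(s, t). s = t \<or> {s, t} = {0, \<infinity>}}"

definition cone_closure :: "('v, 'e, 'l) graph \<Rightarrow> ('e \<Rightarrow> ennreal set) topology" where
  "cone_closure G = product_topology (\<lambda>_. closed_ray) (edges G)"

text \<open>A point \<open>x\<close> of \<open>cone_closure G\<close> determines the metric graph obtained by contracting
  \<open>vanishing G x\<close>, with edge lengths \<open>edge_length x\<close>; the latter is only meaningful off
  \<open>vanishing G x\<close>, where \<open>x e\<close> is a singleton.\<close>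

definition vanishing :: "('v, 'e, 'l) graph \<Rightarrow> ('e \<Rightarrow> ennreal set) \<Rightarrow> 'e set" where
  "vanishing G x = {e\<in>edges G. x e = {0, \<infinity>}}"

definition edge_length :: "('e \<Rightarrow> ennreal set) \<Rightarrow> 'e \<Rightarrow> real" where
  "edge_length x e = enn2real (the_elem (x e))"

definition same_metric_graph_rel ::
  "('v, 'e, 'l) graph \<Rightarrow> ('v \<Rightarrow> nat) \<Rightarrow>
    (('e \<Rightarrow> ennreal set) \<times> ('e \<Rightarrow> ennreal set)) set" where
  "same_metric_graph_rel G w =
     {(x, y). x \<in> topspace (cone_closure G) \<and> y \<in> topspace (cone_closure G) \<and>
        metric_isomorphic
          (contract G (vanishing G x)) (contract_weight G w (vanishing G x)) (edge_length x)
          (contract G (vanishing G y)) (contract_weight G w (vanishing G y)) (edge_length y)}"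

definition Mtr_closure ::
  "('v, 'e, 'l) graph \<Rightarrow> ('v \<Rightarrow> nat) \<Rightarrow> ('e \<Rightarrow> ennreal set) set topology" where
  "Mtr_closure G w = quotient_topology (cone_closure G) (same_metric_graph_rel G w)"

text \<open>The map identifying \<open>Mtr G' w'\<close>, for \<open>(G', w')\<close> isomorphic to a weighted contraction of
  \<open>(G, w)\<close>, with a part of \<open>Mtr_closure G w\<close>: an orbit \<open>c\<close> of length functions goes to the class
  of all points whose metric graph is isomorphic to \<open>(G', w', \<ell>)\<close> with \<open>\<ell> \<in> c\<close>.\<close>

definition stratum_map ::
  "('v, 'e, 'l) graph \<Rightarrow> ('v \<Rightarrow> nat) \<Rightarrow> ('v2, 'e2, 'l2) graph \<Rightarrow> ('v2 \<Rightarrow> nat) \<Rightarrow>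
    ('e2 \<Rightarrow> real) set \<Rightarrow> ('e \<Rightarrow> ennreal set) set" where
  "stratum_map G w G' w' c =
     {y \<in> topspace (cone_closure G). \<exists>x\<in>c.
        metric_isomorphic G' w' x
          (contract G (vanishing G y)) (contract_weight G w (vanishing G y)) (edge_length y)}"

definition stratum ::
  "('v, 'e, 'l) graph \<Rightarrow> ('v \<Rightarrow> nat) \<Rightarrow> ('v2, 'e2, 'l2) graph \<Rightarrow> ('v2 \<Rightarrow> nat) \<Rightarrow>
    ('e \<Rightarrow> ennreal set) set set" where
  "stratum G w G' w' = stratum_map G w G' w' ` topspace (Mtr G' w')"

section \<open>Surfaces and pants decompositions\<close>

text \<open>Smooth maps on an open set, by iterating Frechet derivatives. The plane is \<open>complex\<close>, but
  differentiability is over the reals.\<close>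

primrec Ck_on ::
  "nat \<Rightarrow> ('a::real_normed_vector \<Rightarrow> 'b::real_normed_vector) \<Rightarrow> 'a set \<Rightarrow> bool" where
  "Ck_on 0 f U \<longleftrightarrow> continuous_on U f"
| "Ck_on (Suc k) f U \<longleftrightarrow>
     (\<forall>x\<in>U. f differentiable (at x)) \<and>
     (\<forall>v. Ck_on k (\<lambda>x. frechet_derivative f (at x) v) U)"

definition smooth_on :: "('a::real_normed_vector \<Rightarrow> 'b::real_normed_vector) \<Rightarrow> 'a set \<Rightarrow> bool" where
  "smooth_on f U \<longleftrightarrow> (\<forall>k. Ck_on k f U)"

definition jacobian_det :: "(complex \<Rightarrow> complex) \<Rightarrow> complex \<Rightarrow> real" where
  "jacobian_det f z =
     (let u = frechet_derivative f (at z) 1; v = frechet_derivative f (at z) \<i>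
      in Re u * Im v - Im u * Re v)"

type_synonym 's chart = "'s set \<times> ('s \<Rightarrow> complex)"

definition is_chart :: "'s topology \<Rightarrow> 's chart \<Rightarrow> bool" where
  "is_chart S = (\<lambda>(U, \<phi>). openin S U \<and> open (\<phi> ` U) \<and>
     homeomorphic_map (subtopology S U) (top_of_set (\<phi> ` U)) \<phi>)"

definition overlap :: "'s chart \<Rightarrow> 's chart \<Rightarrow> complex set" where
  "overlap c d = snd c ` (fst c \<inter> fst d)"

definition transition :: "'s chart \<Rightarrow> 's chart \<Rightarrow> complex \<Rightarrow> complex" where
  "transition c d = snd d \<circ> inv_into (fst c) (snd c)"

definition is_atlas :: "'s topology \<Rightarrow> 's chart set \<Rightarrow> bool" where
  "is_atlas S \<A> \<longleftrightarrow> (\<forall>c\<in>\<A>. is_chart S c) \<and> (\<Union>c\<in>\<A>. fst c) = topspace S"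

definition oriented_smooth_atlas :: "'s topology \<Rightarrow> 's chart set \<Rightarrow> bool" where
  "oriented_smooth_atlas S \<A> \<longleftrightarrow> is_atlas S \<A> \<and>
     (\<forall>c\<in>\<A>. \<forall>d\<in>\<A>. smooth_on (transition c d) (overlap c d) \<and>
        (\<forall>z\<in>overlap c d. jacobian_det (transition c d) z > 0))"

text \<open>The genus \<open>g\<close> is read off from \<open>H\<^sub>1(S) \<cong> \<int>\<^bsup>2g\<^esup>\<close>. Second countability is automatic for a
  compact surface.\<close>

definition closed_oriented_surface :: "nat \<Rightarrow> 's topology \<Rightarrow> 's chart set \<Rightarrow> bool" where
  "closed_oriented_surface g S \<A> \<longleftrightarrow>
     topspace S \<noteq> {} \<and> connected_space S \<and> compact_space S \<and> Hausdorff_space S \<and>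
     oriented_smooth_atlas S \<A> \<and>
     homology_group 1 S \<cong> free_Abelian_group {..<2 * g}"

text \<open>A complex structure inducing the given smooth structure and orientation.\<close>

definition complex_structure :: "'s topology \<Rightarrow> 's chart set \<Rightarrow> 's chart set \<Rightarrow> bool" where
  "complex_structure S \<A> \<C> \<longleftrightarrow> is_atlas S \<C> \<and>
     (\<forall>c\<in>\<C>. \<forall>d\<in>\<C>. transition c d holomorphic_on overlap c d) \<and>
     oriented_smooth_atlas S (\<A> \<union> \<C>)"

definition pointed_riemann_surface ::
  "nat \<Rightarrow> nat \<Rightarrow> 's topology \<Rightarrow> 's chart set \<Rightarrow> 's chart set \<Rightarrow> 's list \<Rightarrow> bool" where
  "pointed_riemann_surface g n S \<A> \<C> ps \<longleftrightarrow>
     closed_oriented_surface g S \<A> \<and> complex_structure S \<A> \<C> \<and>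
     distinct ps \<and> length ps = n \<and> set ps \<subseteq> topspace S"

text \<open>A chart of the smooth structure (not necessarily orientation preserving); equivalently a
  diffeomorphism from an open subset of the surface onto an open subset of the plane.\<close>

definition smooth_chart :: "'s topology \<Rightarrow> 's chart set \<Rightarrow> 's chart \<Rightarrow> bool" where
  "smooth_chart S \<A> c \<longleftrightarrow> is_chart S c \<and>
     (\<forall>d\<in>\<A>. smooth_on (transition c d) (overlap c d) \<and>
             smooth_on (transition d c) (overlap d c))"

text \<open>Closed, i.e. compact and without boundary.\<close>

definition closed_1_submanifold :: "'s topology \<Rightarrow> 's chart set \<Rightarrow> 's set \<Rightarrow> bool" where
  "closed_1_submanifold S \<A> A \<longleftrightarrow> compactin S A \<and>
     (\<forall>a\<in>A. \<exists>U \<phi>. smooth_chart S \<A> (U, \<phi>) \<and> a \<in> U \<and>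
        \<phi> ` (U \<inter> A) = \<phi> ` U \<inter> {z. Im z = 0})"

text \<open>The sphere minus three disjoint closed discs, one of them around infinity.\<close>

definition pants_interior :: "complex set" where
  "pants_interior = ball 0 4 - (cball 2 1 \<union> cball (-2) 1)"

definition complement_components :: "'s topology \<Rightarrow> 's set \<Rightarrow> 's set \<Rightarrow> 's set set" where
  "complement_components S P A =
     connected_components_of (subtopology S (topspace S - (P \<union> A)))"

definition pants_decomposition ::
  "'s topology \<Rightarrow> 's chart set \<Rightarrow> 's set \<Rightarrow> 's set \<Rightarrow> bool" where
  "pants_decomposition S \<A> P A \<longleftrightarrow>
     A \<subseteq> topspace S - P \<and> closed_1_submanifold S \<A> A \<and>
     (\<forall>C\<in>complement_components S P A.
        \<exists>\<phi>. smooth_chart S \<A> (C, \<phi>) \<and> \<phi> ` C = pants_interior)"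

text \<open>A component of the complement lies on one of the two sides of a curve iff the curve is
  contained in its closure, and has a point of \<open>P\<close> as a puncture iff that point lies in its
  closure.\<close>

definition pants_graph :: "'s topology \<Rightarrow> 's set \<Rightarrow> 's set \<Rightarrow> ('s set, 's set, 's) graph" where
  "pants_graph S P A =
     \<lparr> verts = complement_components S P A,
       edges = connected_components_of (subtopology S A),
       leaves = P,
       ends = (\<lambda>\<alpha>. {C \<in> complement_components S P A. \<alpha> \<subseteq> S closure_of C}),
       leaf_at = (\<lambda>p. THE C. C \<in> complement_components S P A \<and> p \<in> S closure_of C) \<rparr>"

definition regular_tropicalization ::
  "'s topology \<Rightarrow> 's chart set \<Rightarrow> 's list \<Rightarrow> ('v, 'e, 'l) graph \<Rightarrow> bool" where
  "regular_tropicalization S \<A> ps G \<longleftrightarrow> is_graph G \<and>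
     (\<exists>A. pants_decomposition S \<A> (set ps) A \<and>
        (\<exists>a b c. is_graph_iso G (pants_graph S (set ps) A) a b c))"

end

theory Submission
  imports Defs
begin

text \<open>The closed cone of \<open>G\<close> is compact Hausdorff, and two of its points have isomorphic metric graphs iff their coordinates
  correspond under an isomorphism between the contractions along their vanishing sets. For each of
  the finitely many such isomorphisms, equality of the corresponding coordinates is a closed condition,
  and at a limit point, where further edges vanish, the isomorphism descends to the contraction of
  these edges. So the relation is closed and the quotient map \<open>q\<close> is closed with Hausdorff
  target. The stratum of \<open>G/Q\<close> is the image under \<open>q\<close> of the points vanishing exactly on
  \<open>Q\<close>, and its closure is the image of the points vanishing at least on \<open>Q\<close>. Counting
  edges shows that the former set is a union of fibres of \<open>q\<close> restricted to the latter, so \<open>q\<close> restricts to a closed map from the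
  open cone of \<open>G/Q\<close> onto the stratum, which makes the stratum map an embedding.\<close>

section \<open>Contractions of weighted graphs\<close>

text \<open>The relation on the closed cone is not the orbit relation of a group: two contractions
  of the same graph may be isomorphic without any automorphism of \<open>G\<close> inducing the
  isomorphism. Arguments for quotients by finite groups therefore do not apply, and compactness
  takes their place: it turns closedness of the relation into closedness of the quotient map. That
  an isomorphism descends to further contractions requires contracting in two stages to give the
  same weights as contracting at once; the Betti numbers are handled through Euler characteristics,
  which add up over the classes being merged. For the strata, the obstacle is that a quotient map
  restricted to a subset need not be a quotient map, and that the points vanishing exactly on
  \<open>Q\<close> need not form a union of fibres in the whole closed cone, as another edge set may
  give an isomorphic contraction.\<close>

lemma is_graphD:
  assumes "is_graph G"
  shows is_graph_finite_verts: "finite (verts G)"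
    and is_graph_finite_edges: "finite (edges G)"
    and is_graph_ends: "e \<in> edges G \<Longrightarrow> ends G e \<subseteq> verts G"
    and is_graph_leaf: "l \<in> leaves G \<Longrightarrow> leaf_at G l \<in> verts G"
  using assms by (auto simp: is_graph_def)

lemma is_graph_endsE:
  assumes "is_graph G" "e \<in> edges G"
  obtains x y where "ends G e = {x, y}" "x \<in> verts G" "y \<in> verts G"
proof -
  have "card (ends G e) = 1 \<or> card (ends G e) = 2" "ends G e \<subseteq> verts G"
    using assms by (auto simp: is_graph_def)
  then obtain x y where "ends G e = {x, y}"
    by (metis card_1_singletonE card_2_iff insert_absorb2)
  with that \<open>ends G e \<subseteq> verts G\<close> show thesis
    by auto
qed

section \<open>Connectedness through a set of edges\<close>

lemma equiv_joined: "equiv (verts G) (joined G Q)"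
proof -
  have "sym {(u, v). \<exists>e\<in>Q. ends G e = {u, v}}"
    by (auto intro!: symI simp: insert_commute)
  then have "sym ({(u, v). \<exists>e\<in>Q. ends G e = {u, v}}\<^sup>*)"
    by (rule sym_rtrancl)
  then show ?thesis
    unfolding joined_def equiv_def
    by (intro conjI refl_onI sym_Int trans_Int trans_rtrancl)
       (auto simp: sym_def trans_def)
qed

lemma joined_edge:
  assumes "e \<in> Q" "ends G e = {x, y}" "x \<in> verts G" "y \<in> verts G"
  shows "(x, y) \<in> joined G Q"
  using assms by (auto simp: joined_def)

lemma joined_subset_verts: "joined G Q \<subseteq> verts G \<times> verts G"
  by (auto simp: joined_def)

text \<open>Serves as induction along paths, with \<open>C\<close> the set of vertices having the
  desired property. Since \<open>{x, y}\<close> is unordered, the closure condition covers both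
  directions of an edge.\<close>

lemma joined_closed_subset:
  assumes "(u, v) \<in> joined G Q" and "u \<in> C"
    and "\<And>e x y. e \<in> Q \<Longrightarrow> ends G e = {x, y} \<Longrightarrow> x \<in> C \<Longrightarrow> y \<in> C"
  shows "v \<in> C"
proof -
  have "(u, v) \<in> {(u, v). \<exists>e\<in>Q. ends G e = {u, v}}\<^sup>*"
    using assms(1) by (simp add: joined_def)
  then show ?thesis
    by (induction rule: rtrancl_induct) (use assms in blast)+
qed

lemma joined_mono: "Q \<subseteq> Q' \<Longrightarrow> joined G Q \<subseteq> joined G Q'"
  unfolding joined_def by (intro Int_mono rtrancl_mono) auto

lemma quotient_eq_image: "A // r = (\<lambda>x. r `` {x}) ` A"
  by (auto simp: quotient_def)

lemma contract_sel:
  "verts (contract G Q) = verts G // joined G Q"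
  "edges (contract G Q) = edges G - Q"
  "leaves (contract G Q) = leaves G"
  "ends (contract G Q) e = (\<lambda>v. joined G Q `` {v}) ` ends G e"
  "leaf_at (contract G Q) l = joined G Q `` {leaf_at G l}"
  by (simp_all add: contract_def)

lemma is_graph_contract:
  assumes "is_graph G"
  shows "is_graph (contract G Q)"
proof -
  have "card ((\<lambda>v. joined G Q `` {v}) ` ends G e) = 1
      \<or> card ((\<lambda>v. joined G Q `` {v}) ` ends G e) = 2" if e: "e \<in> edges G" for e
  proof -
    obtain x y where "ends G e = {x, y}"
      by (rule is_graph_endsE [OF assms e])
    then show ?thesis
      by (cases "joined G Q `` {x} = joined G Q `` {y}") auto
  qed
  then show ?thesis
    using assms unfolding is_graph_def contract_def quotient_eq_image by auto
qed

section \<open>Fibres of a contraction and their Euler characteristic\<close>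

lemma class_subset_verts: "C \<in> verts G // joined G Q \<Longrightarrow> C \<subseteq> verts G"
  using joined_subset_verts by (fastforce simp: quotient_def)

text \<open>Because an edge of \<open>Q\<close> joins its own ends, none runs between two classes
  and each belongs to a single fibre.\<close>

lemma ends_subset_class:
  assumes G: "is_graph G" and Q: "Q \<subseteq> edges G" and C: "C \<in> verts G // joined G Q"
    and e: "e \<in> Q" "x \<in> ends G e" "x \<in> C"
  shows "ends G e \<subseteq> C"
proof
  fix y assume y: "y \<in> ends G e"
  obtain p q where pq: "ends G e = {p, q}" "p \<in> verts G" "q \<in> verts G"
    by (rule is_graph_endsE [OF G subsetD [OF Q e(1)]])
  have "(p, q) \<in> joined G Q"
    by (rule joined_edge [OF e(1) pq])
  moreover have "(p, p) \<in> joined G Q" "(q, q) \<in> joined G Q" "sym (joined G Q)"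
    using pq equiv_joined [of G Q] by (auto simp: equiv_def refl_on_def)
  ultimately have "(x, y) \<in> joined G Q"
    using y e pq by (auto dest: symD)
  then show "y \<in> C"
    using C e in_quotient_imp_closed [OF equiv_joined] by metis
qed

text \<open>A spanning tree argument without the tree: a largest vertex set \<open>D\<close> in the
  class obeying the bound is the whole class, since an edge leaving \<open>D\<close> allows adding
  one vertex and at least one edge. The bound makes the truncated subtraction in
  \<open>betti1\<close> exact for fibres.\<close>

lemma card_connected_le:
  assumes G: "is_graph G" and Q: "Q \<subseteq> edges G" and C: "C \<in> verts G // joined G Q"
  shows "card C \<le> card {e \<in> Q. ends G e \<subseteq> C} + 1"
proof -
  have finC: "finite C" and finQ: "finite Q"
    using class_subset_verts [OF C] is_graph_finite_verts [OF G] is_graph_finite_edges [OF G] Q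
      finite_subset by blast+
  let ?P = "\<lambda>D. D \<noteq> {} \<and> D \<subseteq> C \<and> card D \<le> card {e \<in> Q. ends G e \<subseteq> D} + 1"
  obtain u where u: "u \<in> C"
    using C equiv_joined by (metis equals0I in_quotient_imp_non_empty)
  have "?P {u}"
    using u by auto
  moreover have "\<forall>D. ?P D \<longrightarrow> card D < Suc (card C)"
    using finC by (auto simp: less_Suc_eq_le intro!: card_mono)
  ultimately have "\<exists>D. ?P D \<and> (\<forall>D'. ?P D' \<longrightarrow> card D' \<le> card D)"
    by (rule Lattices_Big.ex_has_greatest_nat)
  then obtain D where D: "?P D" and max: "\<And>D'. ?P D' \<Longrightarrow> card D' \<le> card D"
    by blast
  have "D = C"
  proof (rule ccontr)
    assume "D \<noteq> C"
    then obtain v where v: "v \<in> C" "v \<notin> D" using D by auto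
    obtain d where d: "d \<in> D" using D by auto
    have "(d, v) \<in> joined G Q"
      using in_quotient_imp_in_rel [OF equiv_joined C] d v D by blast
    \<comment> \<open>If no edge of \<open>Q\<close> left \<open>D\<close>, this set would be closed
      under \<open>Q\<close> and contain \<open>v\<close>.\<close>
    from joined_closed_subset [OF this d] v(2)
    obtain e x y where e: "e \<in> Q" "ends G e = {x, y}" "x \<in> D" "y \<notin> D"
      by blast
    have "y \<in> C"
      using ends_subset_class [OF G Q C e(1), of x] e D by auto
    have "e \<in> {e \<in> Q. ends G e \<subseteq> insert y D} - {e \<in> Q. ends G e \<subseteq> D}"
      using e by auto
    then have "{e \<in> Q. ends G e \<subseteq> D} \<subset> {e \<in> Q. ends G e \<subseteq> insert y D}"
      by blast
    then have "card {e \<in> Q. ends G e \<subseteq> D} < card {e \<in> Q. ends G e \<subseteq> insert y D}"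
      using finQ by (intro psubset_card_mono) auto
    moreover have "card (insert y D) = Suc (card D)"
      using e D finC finite_subset by (metis card_insert_disjoint)
    ultimately have "?P (insert y D)"
      using D \<open>y \<in> C\<close> by auto
    from max [OF this] \<open>card (insert y D) = Suc (card D)\<close> show False by simp
  qed
  with D show ?thesis by blast
qed

text \<open>A path through \<open>Q\<close> that starts in a class never leaves it, hence it is a
  path in the fibre.\<close>

lemma joined_fibre:
  assumes G: "is_graph G" and Q: "Q \<subseteq> edges G" and C: "C \<in> verts G // joined G Q"
  shows "joined (fibre G Q C) (edges (fibre G Q C)) = C \<times> C"
proof
  show "joined (fibre G Q C) (edges (fibre G Q C)) \<subseteq> C \<times> C"
    by (auto simp: joined_def fibre_def)
  show "C \<times> C \<subseteq> joined (fibre G Q C) (edges (fibre G Q C))"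
  proof clarify
    fix u v assume u: "u \<in> C" and v: "v \<in> C"
    let ?J = "joined (fibre G Q C) (edges (fibre G Q C))"
    have eq: "equiv C ?J"
      using equiv_joined [of "fibre G Q C"] by (simp add: fibre_def)
    have "(u, v) \<in> joined G Q"
      using in_quotient_imp_in_rel [OF equiv_joined C] u v by blast
    then have "v \<in> ?J `` {u}"
    proof (rule joined_closed_subset)
      show "u \<in> ?J `` {u}"
        using eq u by (auto simp: equiv_def refl_on_def)
      show "y \<in> ?J `` {u}" if e: "e \<in> Q" "ends G e = {x, y}" "x \<in> ?J `` {u}" for e x y
      proof -
        have "x \<in> C"
          using e(3) joined_subset_verts [of "fibre G Q C"] by (auto simp: fibre_def)
        then have "{x, y} \<subseteq> C"
          using ends_subset_class [OF G Q C e(1), of x] e by auto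
        then have "(x, y) \<in> ?J"
          using e by (intro joined_edge [of e]) (auto simp: fibre_def)
        then show ?thesis
          using e(3) eq by (auto simp: equiv_def elim: transE)
      qed
    qed
    then show "(u, v) \<in> ?J" by simp
  qed
qed

text \<open>Every fibre is connected, so its first Betti number is one minus its Euler
  characteristic; in this form weights are additive along iterated contractions.\<close>

lemma contract_weight_eq:
  assumes G: "is_graph G" and Q: "Q \<subseteq> edges G" and C: "C \<in> verts G // joined G Q"
  shows "int (contract_weight G w Q C) =
    int (card {e \<in> Q. ends G e \<subseteq> C}) + 1 - int (card C) + (\<Sum>v\<in>C. int (w v))"
proof -
  have "C \<noteq> {}"
    using C equiv_joined by (metis in_quotient_imp_non_empty)
  then have "C // (C \<times> C) = {C}"
    by (auto simp: quotient_def)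
  then have "card (verts (fibre G Q C) // joined (fibre G Q C) (edges (fibre G Q C))) = 1"
    by (simp only: joined_fibre [OF G Q C]) (simp add: fibre_def)
  then show ?thesis
    using card_connected_le [OF G Q C] unfolding contract_weight_def betti1_def
    by (simp add: fibre_def)
qed

section \<open>Isomorphisms of weighted graphs and their effect on contractions\<close>

lemma is_weighted_iso_id: "is_weighted_iso G w G w id id id"
  by (simp add: is_weighted_iso_def is_graph_iso_def)

lemma is_weighted_iso_comp:
  assumes "is_weighted_iso G w G' w' a b c" "is_weighted_iso G' w' G'' w'' a' b' c'"
  shows "is_weighted_iso G w G'' w'' (a' \<circ> a) (b' \<circ> b) (c' \<circ> c)"
  using assms unfolding is_weighted_iso_def is_graph_iso_def
  by (auto intro: bij_betw_trans simp: bij_betw_apply image_comp)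

text \<open>\<open>is_graph G\<close> places ends and leaves inside \<open>verts G\<close>, where
  \<open>inv_into\<close> undoes \<open>a\<close>.\<close>

lemma is_weighted_iso_inv:
  assumes G: "is_graph G" and iso: "is_weighted_iso G w G' w' a b c"
  shows "is_weighted_iso G' w' G w
    (inv_into (verts G) a) (inv_into (edges G) b) (inv_into (leaves G) c)"
proof -
  have bij: "bij_betw a (verts G) (verts G')" "bij_betw b (edges G) (edges G')"
      "bij_betw c (leaves G) (leaves G')"
    and compat: "\<And>e. e \<in> edges G \<Longrightarrow> ends G' (b e) = a ` ends G e"
      "\<And>l. l \<in> leaves G \<Longrightarrow> leaf_at G' (c l) = a (leaf_at G l)"
      "\<And>v. v \<in> verts G \<Longrightarrow> w' (a v) = w v"
    using iso by (auto simp: is_weighted_iso_def is_graph_iso_def)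
  have "ends G (inv_into (edges G) b e) = inv_into (verts G) a ` ends G' e" if "e \<in> edges G'" for e
  proof -
    obtain d where d: "d \<in> edges G" "e = b d"
      using bij(2) \<open>e \<in> edges G'\<close> by (auto simp: bij_betw_def)
    moreover have "inv_into (verts G) a ` a ` ends G d = ends G d"
      using bij(1) is_graph_ends [OF G d(1)] by (auto simp: bij_betw_def intro: inv_into_image_cancel)
    ultimately show ?thesis
      using bij(2) compat(1) by (auto simp: bij_betw_def)
  qed
  moreover have "leaf_at G (inv_into (leaves G) c l) = inv_into (verts G) a (leaf_at G' l)"
    if "l \<in> leaves G'" for l
  proof -
    obtain k where "k \<in> leaves G" "l = c k"
      using bij(3) \<open>l \<in> leaves G'\<close> by (auto simp: bij_betw_def)
    then show ?thesis
      using bij(1,3) compat(2) is_graph_leaf [OF G] by (simp add: bij_betw_def)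
  qed
  moreover have "w (inv_into (verts G) a v) = w' v" if "v \<in> verts G'" for v
    using bij(1) compat(3) that by (metis bij_betw_def f_inv_into_f inv_into_into)
  ultimately show ?thesis
    using bij by (simp add: is_weighted_iso_def is_graph_iso_def bij_betw_inv_into)
qed

text \<open>Permits passing to an extensional edge map, of which there are finitely many between
  finite edge sets, and simplifying composites that contain \<open>inv_into\<close>.\<close>

lemma is_weighted_iso_cong_edges:
  assumes "is_weighted_iso G w G' w' a b c" "\<And>e. e \<in> edges G \<Longrightarrow> b' e = b e"
  shows "is_weighted_iso G w G' w' a b' c"
  using assms unfolding is_weighted_iso_def is_graph_iso_def
  by (simp cong: bij_betw_cong)

lemma joined_iso:
  assumes G: "is_graph G" and Q: "Q \<subseteq> edges G" and iso: "is_graph_iso G G' a b c"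
    and uv: "(u, v) \<in> joined G Q"
  shows "(a u, a v) \<in> joined G' (b ` Q)"
proof -
  have a: "a x \<in> verts G'" if "x \<in> verts G" for x
    using iso that by (auto simp: is_graph_iso_def bij_betw_def)
  have u: "u \<in> verts G"
    using uv joined_subset_verts by blast
  have "v \<in> {v \<in> verts G. (a u, a v) \<in> joined G' (b ` Q)}"
    using uv
  proof (rule joined_closed_subset)
    show "u \<in> {v \<in> verts G. (a u, a v) \<in> joined G' (b ` Q)}"
      using u a equiv_joined [of G' "b ` Q"] by (auto simp: equiv_def refl_on_def)
    show "y \<in> {v \<in> verts G. (a u, a v) \<in> joined G' (b ` Q)}"
      if e: "e \<in> Q" "ends G e = {x, y}" "x \<in> {v \<in> verts G. (a u, a v) \<in> joined G' (b ` Q)}"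
      for e x y
    proof -
      have "x \<in> verts G" "y \<in> verts G"
        using e Q is_graph_ends [OF G, of e] by auto
      moreover have "ends G' (b e) = {a x, a y}"
        using e Q iso by (auto simp: is_graph_iso_def)
      ultimately have "(a x, a y) \<in> joined G' (b ` Q)"
        using e a by (intro joined_edge [of "b e"]) auto
      then show ?thesis
        using e \<open>y \<in> verts G\<close> equiv_joined [of G' "b ` Q"] by (auto simp: equiv_def elim: transE)
    qed
  qed
  then show ?thesis by blast
qed

lemma joined_iso_iff:
  assumes G: "is_graph G" and Q: "Q \<subseteq> edges G" and iso: "is_weighted_iso G w G' w' a b c"
    and uv: "u \<in> verts G" "v \<in> verts G" and G': "is_graph G'"
  shows "(a u, a v) \<in> joined G' (b ` Q) \<longleftrightarrow> (u, v) \<in> joined G Q"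
proof
  have gi: "is_graph_iso G G' a b c" and bij: "inj_on a (verts G)" "inj_on b (edges G)"
      "b ` edges G = edges G'"
    using iso by (auto simp: is_weighted_iso_def is_graph_iso_def bij_betw_def)
  show "(a u, a v) \<in> joined G' (b ` Q)" if "(u, v) \<in> joined G Q"
    using joined_iso [OF G Q gi that] .
  assume "(a u, a v) \<in> joined G' (b ` Q)"
  \<comment> \<open>The converse is the forward direction for the inverse isomorphism, which carries
    the image of \<open>Q\<close> back to \<open>Q\<close>.\<close>
  then have "(inv_into (verts G) a (a u), inv_into (verts G) a (a v))
      \<in> joined G (inv_into (edges G) b ` b ` Q)"
    using is_weighted_iso_inv [OF G iso] Q bij
    by (intro joined_iso [OF G', where c = "inv_into (leaves G) c"])
       (auto simp: is_weighted_iso_def)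
  then show "(u, v) \<in> joined G Q"
    using uv bij Q by (simp add: inv_into_image_cancel)
qed

lemma joined_class_iso:
  assumes G: "is_graph G" and Q: "Q \<subseteq> edges G" and iso: "is_weighted_iso G w G' w' a b c"
    and u: "u \<in> verts G" and G': "is_graph G'"
  shows "a ` (joined G Q `` {u}) = joined G' (b ` Q) `` {a u}"
proof -
  have img: "a ` verts G = verts G'"
    using iso by (auto simp: is_weighted_iso_def is_graph_iso_def bij_betw_def)
  have iff: "(a u, a v) \<in> joined G' (b ` Q) \<longleftrightarrow> (u, v) \<in> joined G Q" if "v \<in> verts G" for v
    using joined_iso_iff [OF G Q iso u that G'] .
  have "joined G Q `` {u} = {v \<in> verts G. (u, v) \<in> joined G Q}"
    using joined_subset_verts by fastforce
  moreover have "joined G' (b ` Q) `` {a u} = {v \<in> a ` verts G. (a u, v) \<in> joined G' (b ` Q)}"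
    using joined_subset_verts unfolding img by fastforce
  ultimately show ?thesis
    using iff by auto
qed

text \<open>The vertices of a contraction are sets of vertices, so the induced vertex map is
  \<open>image a\<close>. Weights agree because \<open>a\<close> and \<open>b\<close> preserve every
  term of the Euler characteristic formula for a class.\<close>

lemma is_weighted_iso_contract:
  assumes G: "is_graph G" and Q: "Q \<subseteq> edges G" and iso: "is_weighted_iso G w G' w' a b c"
    and G': "is_graph G'"
  shows "is_weighted_iso (contract G Q) (contract_weight G w Q)
     (contract G' (b ` Q)) (contract_weight G' w' (b ` Q)) (image a) b c"
proof -
  have bij: "inj_on a (verts G)" "a ` verts G = verts G'" "inj_on b (edges G)"
      "b ` edges G = edges G'" "bij_betw c (leaves G) (leaves G')"
    and compat: "\<And>e. e \<in> edges G \<Longrightarrow> ends G' (b e) = a ` ends G e"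
      "\<And>l. l \<in> leaves G \<Longrightarrow> leaf_at G' (c l) = a (leaf_at G l)"
      "\<And>v. v \<in> verts G \<Longrightarrow> w' (a v) = w v"
    using iso by (auto simp: is_weighted_iso_def is_graph_iso_def bij_betw_def)
  note cl = joined_class_iso [OF G Q iso _ G']
  have Q': "b ` Q \<subseteq> edges G'"
    using image_mono [OF Q, of b] by (simp only: bij(4))
  have img: "image a ` (verts G // joined G Q) = verts G' // joined G' (b ` Q)"
  proof -
    have "image a ` (verts G // joined G Q) = (\<lambda>u. a ` (joined G Q `` {u})) ` verts G"
      by (simp only: quotient_eq_image image_image)
    also have "\<dots> = (\<lambda>u. joined G' (b ` Q) `` {a u}) ` verts G"
      using cl by (rule image_cong [OF refl])
    also have "\<dots> = verts G' // joined G' (b ` Q)"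
      by (simp only: quotient_eq_image image_image bij(2) [symmetric])
    finally show ?thesis .
  qed
  have inj: "inj_on (image a) (verts G // joined G Q)"
    using bij(1) class_subset_verts [of _ G Q] by (intro inj_onI) (metis inj_on_image_eq_iff)
  have "contract_weight G' w' (b ` Q) (a ` C) = contract_weight G w Q C"
    if C: "C \<in> verts G // joined G Q" for C
  proof -
    have CV: "C \<subseteq> verts G"
      using class_subset_verts [OF C] .
    have sub: "ends G' (b e) \<subseteq> a ` C \<longleftrightarrow> ends G e \<subseteq> C" if "e \<in> Q" for e
    proof -
      have "ends G e \<subseteq> verts G" "ends G' (b e) = a ` ends G e"
        using that Q is_graph_ends [OF G] compat by auto
      then show ?thesis
        using inj_on_image_subset_iff [OF bij(1) _ CV] by metis
    qed
    then have "{e \<in> b ` Q. ends G' e \<subseteq> a ` C} = b ` {e \<in> Q. ends G e \<subseteq> C}"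
      by auto
    moreover have "inj_on b {e \<in> Q. ends G e \<subseteq> C}"
      using Q by (intro inj_on_subset [OF bij(3)]) auto
    ultimately have "card {e \<in> b ` Q. ends G' e \<subseteq> a ` C} = card {e \<in> Q. ends G e \<subseteq> C}"
      by (simp add: card_image)
    moreover have inj_C: "inj_on a C"
      using bij(1) CV by (rule inj_on_subset)
    then have "(\<Sum>v\<in>a ` C. int (w' v)) = (\<Sum>v\<in>C. int (w v))"
      using compat(3) CV by (subst sum.reindex) (auto intro!: sum.cong)
    moreover have "a ` C \<in> verts G' // joined G' (b ` Q)"
      using C img by blast
    ultimately have "int (contract_weight G' w' (b ` Q) (a ` C)) = int (contract_weight G w Q C)"
      using inj_C by (simp add: contract_weight_eq [OF G Q C] contract_weight_eq [OF G' Q'] card_image)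
    then show ?thesis by simp
  qed
  moreover have "bij_betw b (edges G - Q) (edges G' - b ` Q)"
    using bij(3,4) Q by (auto simp: bij_betw_def inj_on_diff inj_on_image_set_diff [of b "edges G"])
  moreover have "joined G' (b ` Q) `` {leaf_at G' (c l)} = a ` joined G Q `` {leaf_at G l}"
    if "l \<in> leaves G" for l
    using that compat(2) cl is_graph_leaf [OF G] by simp
  moreover have "(\<lambda>v. joined G' (b ` Q) `` {v}) ` ends G' (b e) =
      image a ` (\<lambda>v. joined G Q `` {v}) ` ends G e" if "e \<in> edges G" for e
    unfolding compat(1) [OF that] image_image
    using cl is_graph_ends [OF G that] by (intro image_cong [OF refl]) auto
  ultimately show ?thesis
    using img inj bij(5) by (simp add: is_weighted_iso_def is_graph_iso_def contract_def bij_betw_def)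
qed

section \<open>Contracting in two stages\<close>

lemma joined_contract_iff:
  assumes G: "is_graph G" and Q: "Q \<subseteq> edges G" and T: "T \<subseteq> edges G - Q"
    and u: "u \<in> verts G" and v: "v \<in> verts G"
  shows "(joined G Q `` {u}, joined G Q `` {v}) \<in> joined (contract G Q) T
    \<longleftrightarrow> (u, v) \<in> joined G (Q \<union> T)"
proof
  let ?q = "\<lambda>v. joined G Q `` {v}"
  have eqQ: "equiv (verts G) (joined G Q)" and eqQT: "equiv (verts G) (joined G (Q \<union> T))"
    by (rule equiv_joined)+
  have q_eq: "?q x = ?q y \<longleftrightarrow> (x, y) \<in> joined G Q" if "x \<in> verts G" "y \<in> verts G" for x y
    using eq_equiv_class_iff [OF eqQ that] .
  have sub: "joined G Q \<subseteq> joined G (Q \<union> T)"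
    by (rule joined_mono) auto
  have q_in: "?q x \<in> verts (contract G Q)" if "x \<in> verts G" for x
    using that by (auto simp: contract_def quotientI)
  have eqT: "equiv (verts (contract G Q)) (joined (contract G Q) T)"
    by (rule equiv_joined)
  {
    assume uv: "(?q u, ?q v) \<in> joined (contract G Q) T"
    \<comment> \<open>An edge of the contraction determines only classes, so the invariant has to
      hold for every vertex \<open>x\<close> representing \<open>D\<close>.\<close>
    let ?C = "{D. \<forall>x\<in>verts G. ?q x = D \<longrightarrow> (u, x) \<in> joined G (Q \<union> T)}"
    have "?q v \<in> ?C"
      using uv
    proof (rule joined_closed_subset)
      show "?q u \<in> ?C"
        using u q_eq sub by blast
      show "D' \<in> ?C" if e: "e \<in> T" "ends (contract G Q) e = {D, D'}" "D \<in> ?C" for e D D'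
      proof -
        obtain x y where xy: "ends G e = {x, y}" "x \<in> verts G" "y \<in> verts G"
          using is_graph_endsE [OF G, of e] e(1) T by blast
        then have "{?q x, ?q y} = {D, D'}"
          using e(2) by (simp add: contract_def)
        \<comment> \<open>The pair is unordered, so the ends may have to be swapped to match
          \<open>D\<close> and \<open>D'\<close>.\<close>
        then obtain x y where xy: "ends G e = {x, y}" "x \<in> verts G" "y \<in> verts G" "?q x = D" "?q y = D'"
          using xy by (metis doubleton_eq_iff)
        have "(x, y) \<in> joined G (Q \<union> T)"
          using e(1) xy by (intro joined_edge [of e]) auto
        moreover have "(u, x) \<in> joined G (Q \<union> T)"
          using e(3) xy by blast
        moreover have "(y, z) \<in> joined G (Q \<union> T)" if "z \<in> verts G" "?q z = D'" for z
          using that xy q_eq sub by blast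
        moreover have "trans (joined G (Q \<union> T))"
          using eqQT by (simp add: equiv_def)
        ultimately show ?thesis
          by (blast dest: transD)
      qed
    qed
    then show "(u, v) \<in> joined G (Q \<union> T)"
      using v by blast
  }
  assume uv: "(u, v) \<in> joined G (Q \<union> T)"
  have "v \<in> {x \<in> verts G. (?q u, ?q x) \<in> joined (contract G Q) T}"
    using uv
  proof (rule joined_closed_subset)
    show "u \<in> {x \<in> verts G. (?q u, ?q x) \<in> joined (contract G Q) T}"
      using u q_in eqT by (auto simp: equiv_def refl_on_def)
    show "y \<in> {x \<in> verts G. (?q u, ?q x) \<in> joined (contract G Q) T}"
      if e: "e \<in> Q \<union> T" "ends G e = {x, y}" "x \<in> {x \<in> verts G. (?q u, ?q x) \<in> joined (contract G Q) T}"
      for e x y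
    proof -
      have xy: "x \<in> verts G" "y \<in> verts G"
        using e Q T is_graph_ends [OF G, of e] by auto
      \<comment> \<open>An edge of \<open>Q\<close> is collapsed, so its ends have the same class;
        an edge of \<open>T\<close> survives and joins the two classes.\<close>
      have "(?q x, ?q y) \<in> joined (contract G Q) T"
      proof (cases "e \<in> Q")
        case True
        then have "?q x = ?q y"
          using q_eq xy joined_edge e(2) by metis
        then show ?thesis
          using eqT q_in xy by (auto simp: equiv_def refl_on_def)
      next
        case False
        then show ?thesis
          using e xy q_in by (intro joined_edge [of e]) (auto simp: contract_def)
      qed
      then show ?thesis
        using e(3) xy eqT by (auto simp: equiv_def elim: transE)
    qed
  qed
  then show "(?q u, ?q v) \<in> joined (contract G Q) T" by blast
qed

text \<open>A vertex of the double contraction is a set of sets of vertices; flattening it yields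
  the vertex of the contraction done at once. So \<open>Union\<close> can be the vertex map of the
  comparison below.\<close>

lemma Union_joined_contract_class:
  assumes G: "is_graph G" and Q: "Q \<subseteq> edges G" and T: "T \<subseteq> edges G - Q" and u: "u \<in> verts G"
  shows "\<Union>(joined (contract G Q) T `` {joined G Q `` {u}}) = joined G (Q \<union> T) `` {u}"
proof -
  let ?q = "\<lambda>v. joined G Q `` {v}"
  have *: "x \<in> ?q y \<longleftrightarrow> x \<in> verts G \<and> ?q x = ?q y" if "y \<in> verts G" for x y
    using that eq_equiv_class_iff [OF equiv_joined, of y G x Q] joined_subset_verts [of G Q] by auto
  have "x \<in> \<Union>(joined (contract G Q) T `` {?q u}) \<longleftrightarrow>
      (\<exists>y\<in>verts G. (?q u, ?q y) \<in> joined (contract G Q) T \<and> x \<in> ?q y)" for x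
    using joined_subset_verts [of "contract G Q" T] by (auto 0 4 simp: contract_def quotient_def)
  also have "\<dots> x \<longleftrightarrow> x \<in> verts G \<and> (?q u, ?q x) \<in> joined (contract G Q) T" for x
    using * by auto
  also have "\<dots> x \<longleftrightarrow> (u, x) \<in> joined G (Q \<union> T)" for x
    using joined_contract_iff [OF G Q T u, of x] joined_subset_verts [of G "Q \<union> T"] by auto
  finally show ?thesis by auto
qed

text \<open>The weights are the delicate point. Over a vertex \<open>D\<close> of the double
  contraction, the edges of \<open>Q\<close> split among the classes in \<open>D\<close>, the edges
  of \<open>T\<close> are those of the fibre of \<open>D\<close>, and vertices and weights are
  summed class by class.\<close>

lemma is_weighted_iso_contract_contract:
  assumes G: "is_graph G" and Q: "Q \<subseteq> edges G" and T: "T \<subseteq> edges G - Q"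
  shows "is_weighted_iso
     (contract (contract G Q) T) (contract_weight (contract G Q) (contract_weight G w Q) T)
     (contract G (Q \<union> T)) (contract_weight G w (Q \<union> T)) Union id id"
proof -
  let ?q = "\<lambda>v. joined G Q `` {v}" and ?H = "contract G Q"
  have H: "is_graph ?H"
    using is_graph_contract [OF G] .
  have TH: "T \<subseteq> edges ?H" and QT: "Q \<union> T \<subseteq> edges G"
    using T Q by (auto simp: contract_def)
  have VH: "verts ?H = ?q ` verts G"
    by (simp add: contract_def quotient_eq_image)
  note cl = Union_joined_contract_class [OF G Q T]
  have img: "Union ` (verts ?H // joined ?H T) = verts G // joined G (Q \<union> T)"
    unfolding quotient_eq_image VH image_image by (rule image_cong [OF refl cl])
  have inj: "inj_on Union (verts ?H // joined ?H T)"
  proof (rule inj_onI)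
    fix D D' assume D: "D \<in> verts ?H // joined ?H T" "D' \<in> verts ?H // joined ?H T" "\<Union>D = \<Union>D'"
    obtain u v where uv: "u \<in> verts G" "v \<in> verts G"
        "D = joined ?H T `` {?q u}" "D' = joined ?H T `` {?q v}"
      using D(1,2) unfolding VH quotient_eq_image by auto
    then have "(u, v) \<in> joined G (Q \<union> T)"
      using D(3) cl eq_equiv_class_iff [OF equiv_joined] by metis
    then have "(?q u, ?q v) \<in> joined ?H T"
      using joined_contract_iff [OF G Q T] uv by blast
    then show "D = D'"
      using uv equiv_class_eq [OF equiv_joined] by metis
  qed
  have "contract_weight G w (Q \<union> T) (\<Union>D) = contract_weight ?H (contract_weight G w Q) T D"
    if D: "D \<in> verts ?H // joined ?H T" for D
  proof -
    have DU: "\<Union>D \<in> verts G // joined G (Q \<union> T)"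
      using D img by blast
    have DH: "D \<subseteq> verts G // joined G Q"
      using class_subset_verts [OF D] by (simp add: contract_def)
    have DV: "\<Union>D \<subseteq> verts G"
      using DH class_subset_verts by blast
    have finV: "finite (\<Union>D)" and finQ: "finite Q" and finT: "finite T"
      using finite_subset [OF DV is_graph_finite_verts [OF G]]
        finite_subset [OF QT is_graph_finite_edges [OF G]] by auto
    have finD: "finite D" "\<forall>A\<in>D. finite A"
      using finite_UnionD [OF finV] finite_subset [OF Union_upper finV] by auto
    have disj: "A = A'" if "A \<in> D" "A' \<in> D" "x \<in> A" "x \<in> A'" for A A' x
      using quotient_disj [OF equiv_joined [of G Q], of A A'] that DH by blast
    have ends_T: "ends ?H e \<subseteq> D \<longleftrightarrow> ends G e \<subseteq> \<Union>D" if "e \<in> T" for e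
    proof -
      have "?q x \<in> D \<longleftrightarrow> x \<in> \<Union>D" if "x \<in> verts G" for x
      proof
        show "x \<in> \<Union>D" if "?q x \<in> D"
          using that equiv_class_self [OF equiv_joined \<open>x \<in> verts G\<close>] by blast
        assume "x \<in> \<Union>D"
        then obtain A where "A \<in> D" "x \<in> A" by auto
        moreover have "A = ?q x"
          using \<open>A \<in> D\<close> \<open>x \<in> A\<close> DH quotient_disj [OF equiv_joined [of G Q], of A "?q x"]
            equiv_class_self [OF equiv_joined \<open>x \<in> verts G\<close>] quotientI [OF \<open>x \<in> verts G\<close>] by blast
        ultimately show "?q x \<in> D" by simp
      qed
      moreover have "ends G e \<subseteq> verts G"
        using that T is_graph_ends [OF G] by auto
      ultimately show ?thesis
        by (simp add: contract_def image_subset_iff) blast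
    qed
    have "{e \<in> Q. ends G e \<subseteq> \<Union>D} = (\<Union>A\<in>D. {e \<in> Q. ends G e \<subseteq> A})"
    proof (intro equalityI subsetI)
      fix e assume "e \<in> {e \<in> Q. ends G e \<subseteq> \<Union>D}"
      then have e: "e \<in> Q" "ends G e \<subseteq> \<Union>D" by auto
      obtain x where "x \<in> ends G e"
        by (rule is_graph_endsE [OF G subsetD [OF Q e(1)]]) auto
      with e obtain A where "A \<in> D" "x \<in> A" by blast
      then show "e \<in> (\<Union>A\<in>D. {e \<in> Q. ends G e \<subseteq> A})"
        using ends_subset_class [OF G Q _ e(1) \<open>x \<in> ends G e\<close>, of A] DH e(1) by blast
    qed blast
    moreover have "card (\<Union>A\<in>D. {e \<in> Q. ends G e \<subseteq> A}) = (\<Sum>A\<in>D. card {e \<in> Q. ends G e \<subseteq> A})"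
    proof (rule card_UN_disjoint [OF finD(1)])
      show "\<forall>A\<in>D. finite {e \<in> Q. ends G e \<subseteq> A}"
        using finQ by auto
      show "\<forall>A\<in>D. \<forall>A'\<in>D. A \<noteq> A' \<longrightarrow> {e \<in> Q. ends G e \<subseteq> A} \<inter> {e \<in> Q. ends G e \<subseteq> A'} = {}"
      proof (intro ballI impI equals0I)
        fix A A' e assume *: "A \<in> D" "A' \<in> D" "A \<noteq> A'"
          "e \<in> {e \<in> Q. ends G e \<subseteq> A} \<inter> {e \<in> Q. ends G e \<subseteq> A'}"
        then have "e \<in> edges G"
          using Q by blast
        then obtain x where "x \<in> ends G e"
          by (rule is_graph_endsE [OF G]) auto
        with * disj show False by blast
      qed
    qed
    moreover have "{e \<in> Q \<union> T. ends G e \<subseteq> \<Union>D} =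
        {e \<in> Q. ends G e \<subseteq> \<Union>D} \<union> {e \<in> T. ends ?H e \<subseteq> D}"
      using ends_T by auto
    moreover have "card ({e \<in> Q. ends G e \<subseteq> \<Union>D} \<union> {e \<in> T. ends ?H e \<subseteq> D}) =
        card {e \<in> Q. ends G e \<subseteq> \<Union>D} + card {e \<in> T. ends ?H e \<subseteq> D}"
      using finQ finT T by (intro card_Un_disjoint) auto
    ultimately have cE: "int (card {e \<in> Q \<union> T. ends G e \<subseteq> \<Union>D}) =
        (\<Sum>A\<in>D. int (card {e \<in> Q. ends G e \<subseteq> A})) + int (card {e \<in> T. ends ?H e \<subseteq> D})"
      by simp
    have cV: "card (\<Union>D) = (\<Sum>A\<in>D. card A)"
      using finD disj by (intro card_Union_disjoint) (auto simp: pairwise_def disjnt_def)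
    have sw: "(\<Sum>v\<in>\<Union>D. int (w v)) = (\<Sum>A\<in>D. \<Sum>v\<in>A. int (w v))"
      using finD disj sum.Union_disjoint [of D "\<lambda>v. int (w v)"] by (simp add: comp_def) blast
    \<comment> \<open>Every class in \<open>D\<close> contributes a summand 1; together these cancel
      \<open>card D\<close>, the vertex count of the fibre of \<open>D\<close>.\<close>
    have "(\<Sum>A\<in>D. int (contract_weight G w Q A)) = (\<Sum>A\<in>D. int (card {e \<in> Q. ends G e \<subseteq> A}) + 1
        - int (card A) + (\<Sum>v\<in>A. int (w v)))"
      using DH by (intro sum.cong refl contract_weight_eq [OF G Q]) auto
    then have "int (contract_weight G w (Q \<union> T) (\<Union>D)) =
        int (contract_weight ?H (contract_weight G w Q) T D)"
      unfolding contract_weight_eq [OF G QT DU] contract_weight_eq [OF H TH D] cE cV sw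
      by (simp add: sum.distrib sum_subtractf)
    then show ?thesis by simp
  qed
  moreover have "ends (contract G (Q \<union> T)) e = Union ` ends (contract ?H T) e" if "e \<in> edges G" for e
    unfolding contract_sel image_image
    by (rule image_cong [OF refl cl [symmetric]]) (use is_graph_ends [OF G that] in blast)
  moreover have "leaf_at (contract G (Q \<union> T)) l = \<Union>(leaf_at (contract ?H T) l)"
    if "l \<in> leaves G" for l
    unfolding contract_sel by (rule cl [OF is_graph_leaf [OF G that], symmetric])
  moreover have "verts (contract ?H T) = verts ?H // joined ?H T"
      "verts (contract G (Q \<union> T)) = verts G // joined G (Q \<union> T)"
      "edges (contract ?H T) = edges G - (Q \<union> T)" "edges (contract G (Q \<union> T)) = edges G - (Q \<union> T)"
      "leaves (contract ?H T) = leaves G" "leaves (contract G (Q \<union> T)) = leaves G"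
    by (auto simp: contract_sel)
  ultimately show ?thesis
    using img inj by (simp add: is_weighted_iso_def is_graph_iso_def bij_betw_def)
qed

text \<open>Lets the stratum of \<open>G\<close> itself be treated like the others, with
  \<open>Q\<close> empty. A singleton class has an edgeless fibre, hence weight 0 + 1 - 1 +
  \<open>w v\<close>.\<close>

lemma is_weighted_iso_contract_empty:
  assumes G: "is_graph G"
  shows "is_weighted_iso G w (contract G {}) (contract_weight G w {}) (\<lambda>v. {v}) id id"
proof -
  have j: "joined G {} = Id_on (verts G)"
    by (auto simp: joined_def)
  have cl: "joined G {} `` {v} = {v}" if "v \<in> verts G" for v
    using that by (auto simp: j)
  have V: "verts G // joined G {} = (\<lambda>v. {v}) ` verts G"
    using cl by (force simp: quotient_def)
  have "int (contract_weight G w {} {v}) = int (w v)" if "v \<in> verts G" for v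
    using that by (subst contract_weight_eq [OF G]) (auto simp: V)
  moreover have "(\<lambda>v. joined G {} `` {v}) ` ends G e = (\<lambda>v. {v}) ` ends G e" if "e \<in> edges G" for e
    using cl is_graph_ends [OF G that] by (intro image_cong) auto
  ultimately show ?thesis
    using cl is_graph_leaf [OF G]
    by (simp add: is_weighted_iso_def is_graph_iso_def contract_def V bij_betw_def)
qed

text \<open>An isomorphism of two contractions survives contracting corresponding further edges; this
  is what makes the relation defining \<^const>\<open>Mtr_closure\<close> closed.\<close>

lemma is_weighted_iso_contract_more:
  assumes G: "is_graph G" and Q: "Q \<subseteq> edges G" and G': "is_graph G'" and Q': "Q' \<subseteq> edges G'"
    and iso: "is_weighted_iso (contract G Q) (contract_weight G w Q)
        (contract G' Q') (contract_weight G' w' Q') a b c"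
    and T: "T \<subseteq> edges G - Q"
  shows "\<exists>a' c'. is_weighted_iso (contract G (Q \<union> T)) (contract_weight G w (Q \<union> T))
        (contract G' (Q' \<union> b ` T)) (contract_weight G' w' (Q' \<union> b ` T)) a' b c'"
proof -
  let ?H = "contract G Q" and ?H' = "contract G' Q'"
  have b: "b ` (edges G - Q) = edges G' - Q'"
    using iso by (auto simp: is_weighted_iso_def is_graph_iso_def contract_def bij_betw_def)
  have H: "is_graph ?H" "is_graph ?H'" "is_graph (contract ?H T)"
    by (intro is_graph_contract G G')+
  have TH: "T \<subseteq> edges ?H" and T': "b ` T \<subseteq> edges G' - Q'"
    using T b by (auto simp: contract_def)
  have E: "edges (contract ?H T) = edges G - (Q \<union> T)"
    using T by (auto simp: contract_def)
  \<comment> \<open>Split the contraction of \<open>G\<close> into two stages, transport along the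
    given isomorphism, and merge the stages for \<open>G'\<close>.\<close>
  note 1 = is_weighted_iso_inv [OF H(3) is_weighted_iso_contract_contract [OF G Q T, of w]]
  note 2 = is_weighted_iso_contract [OF H(1) TH iso H(2)]
  note 3 = is_weighted_iso_contract_contract [OF G' Q' T', of w']
  note 4 = is_weighted_iso_comp [OF is_weighted_iso_comp [OF 1 2] 3]
  \<comment> \<open>The composite agrees with \<open>b\<close> on the surviving edges, so
    \<open>b\<close> itself can be kept. This matters at limit points, where the same coordinates
    must stay matched.\<close>
  have "b e = (id \<circ> (b \<circ> inv_into (edges (contract ?H T)) id)) e" if "e \<in> edges (contract G (Q \<union> T))" for e
    using that E by (simp add: contract_sel inv_into_f_eq)
  from is_weighted_iso_cong_edges [OF 4 this] show ?thesis
    by blast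
qed

section \<open>Quotients of compact Hausdorff spaces by closed equivalence relations\<close>

text \<open>The saturation of a closed set \<open>C\<close> is the second projection of the part of
  \<open>r\<close> over \<open>C\<close>. Projecting along a compact factor is closed, and a set in
  the quotient is closed as soon as its preimage is.\<close>

lemma closed_map_quotient_topology:
  assumes X: "compact_space X" "Hausdorff_space X"
    and r: "equiv (topspace X) r" "closedin (prod_topology X X) r"
  shows "closed_map X (quotient_topology X r) (\<lambda>x. r `` {x})"
  unfolding closed_map_def
proof (intro allI impI)
  fix C assume C: "closedin X C"
  then have CX: "C \<subseteq> topspace X"
    by (rule closedin_subset)
  have "{x \<in> topspace X. r `` {x} \<in> (\<lambda>x. r `` {x}) ` C} = {x \<in> topspace X. \<exists>c\<in>C. (c, x) \<in> r}"
  proof -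
    have "r `` {x} = r `` {c} \<longleftrightarrow> (c, x) \<in> r" if "c \<in> C" "x \<in> topspace X" for c x
      using that CX eq_equiv_class_iff [OF r(1), of c x] by auto
    then show ?thesis by auto
  qed
  also have "\<dots> = snd ` (r \<inter> C \<times> topspace X)"
    using r(1) by (force simp: equiv_def)
  finally have "{x \<in> topspace X. r `` {x} \<in> (\<lambda>x. r `` {x}) ` C} = snd ` (r \<inter> C \<times> topspace X)" .
  moreover have "closedin (prod_topology X X) (r \<inter> C \<times> topspace X)"
    using r(2) C by (auto intro!: closedin_Int simp: closedin_prod_Times_iff)
  then have "closedin X (snd ` (r \<inter> C \<times> topspace X))"
    using Abstract_Topological_Spaces.closed_map_snd [OF X(1), of X] unfolding closed_map_def by blast
  moreover have "(\<lambda>x. r `` {x}) ` C \<subseteq> topspace (quotient_topology X r)"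
    using CX by (auto intro: quotientI)
  moreover have "closedin (quotient_topology X r) U"
    if "U \<subseteq> topspace (quotient_topology X r)" "closedin X {x \<in> topspace X. r `` {x} \<in> U}" for U
    using quotient_map_quotient_topology [of X r] that unfolding quotient_map_closedin by blast
  ultimately show "closedin (quotient_topology X r) ((\<lambda>x. r `` {x}) ` C)"
    by presburger
qed

lemma compact_space_quotient_topology:
  assumes "compact_space X"
  shows "compact_space (quotient_topology X r)"
  using image_compactin [OF _ quotient_imp_continuous_map [OF quotient_map_quotient_topology [of X r]]]
    assms unfolding compact_space_def
  by (simp add: quotient_eq_image)

text \<open>Quotients need not inherit the Hausdorff property. Normality and T1 pass along closed
  continuous surjections, and together they imply it.\<close>

lemma Hausdorff_space_quotient_topology:
  assumes X: "compact_space X" "Hausdorff_space X"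
    and r: "equiv (topspace X) r" "closedin (prod_topology X X) r"
  shows "Hausdorff_space (quotient_topology X r)"
proof -
  note cl = closed_map_quotient_topology [OF assms]
  note qu = quotient_map_quotient_topology [of X r]
  have "normal_space (quotient_topology X r)"
    using normal_space_continuous_closed_map_image [OF _ quotient_imp_continuous_map [OF qu] cl
        quotient_imp_surjective_map [OF qu]] compact_Hausdorff_or_regular_imp_normal_space X by blast
  moreover have "t1_space (quotient_topology X r)"
    using t1_space_closed_map_image [OF cl quotient_imp_surjective_map [OF qu]]
      Hausdorff_imp_t1_space X(2) by blast
  ultimately show ?thesis
    by (rule normal_t1_imp_Hausdorff_space)
qed

section \<open>The closed ray\<close>

lemma equiv_closed_ray: "equiv UNIV {(s::ennreal, t). s = t \<or> {s, t} = {0, \<infinity>}}"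
  by (rule equivI) (auto intro!: refl_onI symI transI simp: doubleton_eq_iff)

text \<open>The gluing adds just two pairs to the closed diagonal.\<close>

lemma closedin_closed_ray_rel:
  "closedin (prod_topology euclidean euclidean) {(s::ennreal, t). s = t \<or> {s, t} = {0, \<infinity>}}"
proof -
  have "{(s::ennreal, t). s = t \<or> {s, t} = {0, \<infinity>}} = {p. fst p = snd p} \<union> {(0, \<infinity>), (\<infinity>, 0)}"
    by (auto simp: doubleton_eq_iff)
  moreover have "closed ({p :: ennreal \<times> ennreal. fst p = snd p} \<union> {(0, \<infinity>), (\<infinity>, 0)})"
    by (intro closed_Un closed_Collect_eq continuous_intros finite_imp_closed) auto
  ultimately show ?thesis
    by (simp only: prod_topology_euclidean closed_closedin [symmetric])
qed

lemma closed_ray_compact_Hausdorff: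
  shows compact_space_closed_ray: "compact_space closed_ray"
    and Hausdorff_space_closed_ray: "Hausdorff_space closed_ray"
proof -
  have X: "compact_space (euclidean :: ennreal topology)" "Hausdorff_space (euclidean :: ennreal topology)"
    unfolding Hausdorff_space_def disjnt_def open_openin [symmetric]
    using hausdorff compact_UNIV by (simp_all add: compact_space_def) meson
  show "compact_space closed_ray"
    unfolding closed_ray_def by (rule compact_space_quotient_topology [OF X(1)])
  show "Hausdorff_space closed_ray"
    unfolding closed_ray_def
    by (rule Hausdorff_space_quotient_topology [OF X])
       (simp_all only: topspace_euclidean equiv_closed_ray closedin_closed_ray_rel)
qed

section \<open>The circle without its glued point\<close>

definition open_ray :: "ennreal set set" where
  "open_ray = (\<lambda>t. {ennreal t}) ` {0<..}"

lemma ray_classes: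
  "{(s::ennreal, t). s = t \<or> {s, t} = {0, \<infinity>}} `` {x} = (if x \<in> {0, \<infinity>} then {0, \<infinity>} else {x})"
  by (auto simp: doubleton_eq_iff)

lemma ennreal_pos_cases:
  fixes x :: ennreal
  obtains "x \<in> {0, \<infinity>}" | t where "t > 0" "x = ennreal t"
  by (cases x) (auto simp: less_le)

lemma open_ray_class_iff:
  fixes x :: ennreal
  shows "(if x \<in> {0, \<infinity>} then {0, \<infinity>} else {x}) \<in> open_ray \<longleftrightarrow> x \<notin> {0, \<infinity>}"
  by (cases x rule: ennreal_pos_cases) (auto simp: open_ray_def doubleton_eq_iff)

lemma topspace_closed_ray: "topspace closed_ray = insert {0, \<infinity>} open_ray"
proof -
  have "topspace closed_ray = range (\<lambda>x::ennreal. if x \<in> {0, \<infinity>} then {0, \<infinity>} else {x})"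
    unfolding closed_ray_def topspace_quotient_topology quotient_eq_image ray_classes by simp
  also have "\<dots> = insert {0, \<infinity>} open_ray"
  proof
    show "range (\<lambda>x::ennreal. if x \<in> {0, \<infinity>} then {0, \<infinity>} else {x}) \<subseteq> insert {0, \<infinity>} open_ray"
      using open_ray_class_iff by (force split: if_splits)
    show "insert {0, \<infinity>} open_ray \<subseteq> range (\<lambda>x::ennreal. if x \<in> {0, \<infinity>} then {0, \<infinity>} else {x})"
      by (auto simp: open_ray_def image_iff intro: exI [of _ 0])
  qed
  finally show ?thesis .
qed

lemma infinity_notin_open_ray: "{0, \<infinity>} \<notin> open_ray"
  using open_ray_class_iff [of 0] by simp

lemma closedin_closed_ray_infinity: "closedin closed_ray {{0, \<infinity>}}"
  using Hausdorff_imp_t1_space [OF Hausdorff_space_closed_ray]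
  by (auto simp: t1_space_closedin_singleton topspace_closed_ray)

lemma openin_open_ray: "openin closed_ray open_ray"
proof -
  have "open_ray = topspace closed_ray - {{0, \<infinity>}}"
    using infinity_notin_open_ray by (auto simp: topspace_closed_ray)
  then show ?thesis
    using openin_diff [OF openin_topspace closedin_closed_ray_infinity] by (simp only:)
qed

lemma quotient_map_closed_ray:
  "quotient_map euclidean closed_ray (\<lambda>x::ennreal. if x \<in> {0, \<infinity>} then {0, \<infinity>} else {x})"
  using quotient_map_quotient_topology [of euclidean "{(s::ennreal, t). s = t \<or> {s, t} = {0, \<infinity>}}"]
  by (simp only: closed_ray_def ray_classes)

text \<open>For continuity of the inverse, the quotient map is restricted over the open set
  \<open>open_ray\<close>, where it remains a quotient map; composed with it, the inverse is just
  \<open>enn2real\<close>.\<close>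

lemma homeomorphic_maps_open_ray:
  "homeomorphic_maps (top_of_set {0<..}) (subtopology closed_ray open_ray)
     (\<lambda>t. {ennreal t}) (\<lambda>p. enn2real (the_elem p))"
proof -
  let ?q = "\<lambda>x::ennreal. if x \<in> {0, \<infinity>} then {0, \<infinity>} else {x}"
  have q: "continuous_map euclidean closed_ray ?q"
    by (rule quotient_imp_continuous_map [OF quotient_map_closed_ray])
  have "continuous_map (top_of_set {0::real<..}) euclidean ennreal"
    by (simp add: continuous_on_ennreal)
  then have "continuous_map (top_of_set {0<..}) closed_ray (?q \<circ> ennreal)"
    using continuous_map_compose q by blast
  then have "continuous_map (top_of_set {0<..}) closed_ray (\<lambda>t. {ennreal t})"
    by (rule continuous_map_eq) auto
  then have 1: "continuous_map (top_of_set {0<..}) (subtopology closed_ray open_ray) (\<lambda>t. {ennreal t})"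
    by (rule continuous_map_into_subtopology) (auto simp: open_ray_def)
  let ?A = "- {0, \<infinity>} :: ennreal set"
  have quo: "quotient_map (top_of_set ?A) (subtopology closed_ray open_ray) ?q"
    by (rule quotient_map_restriction [OF quotient_map_closed_ray])
       (auto simp only: open_ray_class_iff openin_open_ray topspace_euclidean)
  \<comment> \<open>\<open>enn2real\<close> takes the value 0 at infinity and is not continuous
    there, so that point has to be excluded.\<close>
  have "continuous_on ?A enn2real"
    unfolding continuous_on_def
  proof
    fix x :: ennreal assume "x \<in> ?A"
    then obtain t where "t > 0" "x = ennreal t"
      by (cases x rule: ennreal_pos_cases) auto
    then show "(enn2real \<longlongrightarrow> enn2real x) (at x within ?A)"
      by (auto intro!: tendsto_enn2real tendsto_ident_at)
  qed
  then have "continuous_map (top_of_set ?A) (top_of_set {0<..}) enn2real"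
    by (auto simp: continuous_map_in_subtopology enn2real_positive_iff less_top zero_less_iff_neq_zero)
  then have "continuous_map (top_of_set ?A) (top_of_set {0<..}) ((\<lambda>p. enn2real (the_elem p)) \<circ> ?q)"
    by (rule continuous_map_eq) auto
  then have 2: "continuous_map (subtopology closed_ray open_ray) (top_of_set {0<..})
      (\<lambda>p. enn2real (the_elem p))"
    by (rule continuous_compose_quotient_map [OF quo])
  show ?thesis
    using 1 2 by (auto simp: homeomorphic_maps_def open_ray_def)
qed

lemma closure_of_open_ray: "closed_ray closure_of open_ray = topspace closed_ray"
proof -
  let ?q = "\<lambda>x::ennreal. if x \<in> {0, \<infinity>} then {0, \<infinity>} else {x}"
  \<comment> \<open>Positive finite numbers tending to 0 show that the glued point is a limit of the
    open ray.\<close>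
  have "(\<lambda>n. ennreal (inverse (real (Suc n)))) \<longlonglongrightarrow> ennreal 0"
    by (intro tendsto_ennrealI LIMSEQ_inverse_real_of_nat)
  then have "0 \<in> closure (- {0, \<infinity>} :: ennreal set)"
    unfolding closure_sequential by (intro exI conjI allI) (auto simp: top_unique)
  then have "?q 0 \<in> ?q ` (euclidean closure_of (- {0, \<infinity>}))"
    by (intro imageI) simp
  also have "\<dots> \<subseteq> closed_ray closure_of (?q ` (- {0, \<infinity>}))"
    by (rule continuous_map_image_closure_subset
      [OF quotient_imp_continuous_map [OF quotient_map_closed_ray]])
  also have "\<dots> \<subseteq> closed_ray closure_of open_ray"
    by (intro closure_of_mono image_subsetI) (use open_ray_class_iff in blast)
  finally have "{0, \<infinity>} \<in> closed_ray closure_of open_ray"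
    by simp
  moreover have "open_ray \<subseteq> closed_ray closure_of open_ray"
    by (simp add: closure_of_subset openin_open_ray openin_subset)
  ultimately show ?thesis
    using closure_of_subset_topspace [of closed_ray open_ray] by (auto simp: topspace_closed_ray)
qed

section \<open>The space of metric graphs\<close>

lemma metric_isomorphic_refl: "metric_isomorphic G w x G w x"
  using is_weighted_iso_id [of G w] unfolding metric_isomorphic_def by (metis id_apply)

lemma metric_isomorphic_trans:
  assumes "metric_isomorphic G w x G' w' x'" "metric_isomorphic G' w' x' G'' w'' x''"
  shows "metric_isomorphic G w x G'' w'' x''"
proof -
  obtain a b c a' b' c' where iso: "is_weighted_iso G w G' w' a b c" "is_weighted_iso G' w' G'' w'' a' b' c'"
    and len: "\<forall>e\<in>edges G. x' (b e) = x e" "\<forall>e\<in>edges G'. x'' (b' e) = x' e"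
    using assms unfolding metric_isomorphic_def by blast
  have "b e \<in> edges G'" if "e \<in> edges G" for e
    using iso(1) that by (auto simp: is_weighted_iso_def is_graph_iso_def bij_betw_def)
  then have "\<forall>e\<in>edges G. x'' ((b' \<circ> b) e) = x e"
    using len by simp
  then show ?thesis
    using is_weighted_iso_comp [OF iso] unfolding metric_isomorphic_def by blast
qed

lemma metric_isomorphic_sym:
  assumes G: "is_graph G" and iso: "metric_isomorphic G w x G' w' x'"
  shows "metric_isomorphic G' w' x' G w x"
proof -
  obtain a b c where abc: "is_weighted_iso G w G' w' a b c" "\<forall>e\<in>edges G. x' (b e) = x e"
    using iso unfolding metric_isomorphic_def by blast
  have b: "bij_betw b (edges G) (edges G')"
    using abc(1) by (simp add: is_weighted_iso_def is_graph_iso_def)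
  have "x (inv_into (edges G) b e) = x' e" if "e \<in> edges G'" for e
    using abc(2) b that by (metis bij_betw_def f_inv_into_f inv_into_into)
  then show ?thesis
    using is_weighted_iso_inv [OF G abc(1)] unfolding metric_isomorphic_def by blast
qed

lemma card_edges_iso:
  "is_weighted_iso G w G' w' a b c \<Longrightarrow> card (edges G) = card (edges G')"
  by (auto simp: is_weighted_iso_def is_graph_iso_def intro: bij_betw_same_card)

lemma topspace_cone_closure: "topspace (cone_closure G) = (\<Pi>\<^sub>E e\<in>edges G. insert {0, \<infinity>} open_ray)"
  by (simp add: cone_closure_def topspace_closed_ray)

lemma compact_space_cone_closure: "compact_space (cone_closure G)"
  by (simp add: cone_closure_def compact_space_product_topology compact_space_closed_ray)

lemma Hausdorff_space_cone_closure: "Hausdorff_space (cone_closure G)"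
  by (simp add: cone_closure_def Hausdorff_space_product_topology Hausdorff_space_closed_ray)

lemma vanishing_subset: "vanishing G x \<subseteq> edges G"
  by (auto simp: vanishing_def)

lemma cone_closure_eq_edge_length:
  assumes "x \<in> topspace (cone_closure G)" "e \<in> edges G - vanishing G x"
  shows "x e = {ennreal (edge_length x e)}"
proof -
  have "x e \<in> open_ray"
    using assms by (auto simp: topspace_cone_closure vanishing_def)
  then obtain t where "0 < t" "x e = {ennreal t}"
    unfolding open_ray_def by blast
  then show ?thesis
    by (simp add: edge_length_def)
qed

text \<open>Real edge lengths are replaced by points of \<open>closed_ray\<close>: equality of
  coordinates there is a closed condition and still makes sense at the glued point, unlike
  \<open>edge_length\<close>.\<close>

lemma metric_isomorphic_contract_iff:
  assumes x: "x \<in> topspace (cone_closure G)" and y: "y \<in> topspace (cone_closure G)"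
  shows "metric_isomorphic
      (contract G (vanishing G x)) (contract_weight G w (vanishing G x)) (edge_length x)
      (contract G (vanishing G y)) (contract_weight G w (vanishing G y)) (edge_length y) \<longleftrightarrow>
    (\<exists>a b c. is_weighted_iso
      (contract G (vanishing G x)) (contract_weight G w (vanishing G x))
      (contract G (vanishing G y)) (contract_weight G w (vanishing G y)) a b c \<and>
      (\<forall>e\<in>edges G - vanishing G x. y (b e) = x e))"
proof -
  have "(\<forall>e\<in>edges G - vanishing G x. edge_length y (b e) = edge_length x e) \<longleftrightarrow>
      (\<forall>e\<in>edges G - vanishing G x. y (b e) = x e)"
    if "is_weighted_iso (contract G (vanishing G x)) (contract_weight G w (vanishing G x))
      (contract G (vanishing G y)) (contract_weight G w (vanishing G y)) a b c" for a b c
  proof (rule ball_cong [OF refl])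
    fix e assume e: "e \<in> edges G - vanishing G x"
    then have "b e \<in> edges G - vanishing G y"
      using that by (auto simp: is_weighted_iso_def is_graph_iso_def bij_betw_def contract_sel)
    then show "edge_length y (b e) = edge_length x e \<longleftrightarrow> y (b e) = x e"
      using cone_closure_eq_edge_length [OF x e] cone_closure_eq_edge_length [OF y, of "b e"]
      by (auto simp: edge_length_def)
  qed
  then show ?thesis
    unfolding metric_isomorphic_def contract_sel by blast
qed

lemma equiv_same_metric_graph_rel:
  assumes "is_graph G"
  shows "equiv (topspace (cone_closure G)) (same_metric_graph_rel G w)"
proof (rule equivI)
  show "sym (same_metric_graph_rel G w)"
    unfolding same_metric_graph_rel_def
    using metric_isomorphic_sym [OF is_graph_contract [OF assms]] by (intro symI) blast
  show "trans (same_metric_graph_rel G w)"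
    unfolding same_metric_graph_rel_def
    by (intro transI) (use metric_isomorphic_trans in blast)
qed (auto simp: same_metric_graph_rel_def metric_isomorphic_refl intro!: refl_onI)

section \<open>Closedness of the isomorphism relation\<close>

lemma closedin_UN_finite:
  "finite I \<Longrightarrow> (\<And>i. i \<in> I \<Longrightarrow> closedin X (B i)) \<Longrightarrow> closedin X (\<Union>i\<in>I. B i)"
  by (intro closedin_Union) auto

text \<open>Writing the set as the complement of a union covers the empty index set, for which it is
  the whole space, without a separate case.\<close>

lemma closedin_Collect_Ball:
  assumes "\<And>i. i \<in> I \<Longrightarrow> closedin X {x \<in> topspace X. P i x}"
  shows "closedin X {x \<in> topspace X. \<forall>i\<in>I. P i x}"
proof -
  have "{x \<in> topspace X. \<forall>i\<in>I. P i x} = topspace X - (\<Union>i\<in>I. topspace X - {x \<in> topspace X. P i x})"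
    by auto
  moreover have "openin X (\<Union>i\<in>I. topspace X - {x \<in> topspace X. P i x})"
    using assms by (intro openin_Union) auto
  ultimately show ?thesis
    by (simp only: closedin_diff closedin_topspace)
qed

lemma closedin_same_metric_graph_rel:
  assumes G: "is_graph G"
  shows "closedin (prod_topology (cone_closure G) (cone_closure G)) (same_metric_graph_rel G w)"
proof -
  let ?X = "cone_closure G" and ?E = "edges G"
  let ?iso = "\<lambda>Q Q' b. \<exists>a c. is_weighted_iso (contract G Q) (contract_weight G w Q)
      (contract G Q') (contract_weight G w Q') a b c"
  let ?P = "prod_topology ?X ?X"
  \<comment> \<open>Coordinates outside \<open>Q\<close> and \<open>Q'\<close> may vanish as well;
    forbidding this would spoil closedness. Descent to further contractions shows that such points
    still satisfy the relation.\<close>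
  define F where "F Q Q' b = {z \<in> topspace ?P. \<forall>e\<in>Q. fst z e = {0, \<infinity>}} \<inter>
      {z \<in> topspace ?P. \<forall>e\<in>Q'. snd z e = {0, \<infinity>}} \<inter>
      {z \<in> topspace ?P. \<forall>e\<in>?E - Q. snd z (b e) = fst z e}" for Q Q' and b :: "'b \<Rightarrow> 'b"
  \<comment> \<open>Extensional edge maps make this a finite set. Vertex and leaf maps do not affect
    the lengths and stay existentially quantified.\<close>
  define J where "J Q Q' = {b \<in> (?E - Q) \<rightarrow>\<^sub>E ?E. ?iso Q Q' b}" for Q Q'
  have finE: "finite ?E"
    by (rule is_graph_finite_edges [OF G])
  have eq: "same_metric_graph_rel G w = (\<Union>Q\<in>Pow ?E. \<Union>Q'\<in>Pow ?E. \<Union>b\<in>J Q Q'. F Q Q' b)"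
  proof (intro equalityI subrelI)
    fix x y assume xy: "(x, y) \<in> same_metric_graph_rel G w"
    then have top: "x \<in> topspace ?X" "y \<in> topspace ?X"
      by (auto simp: same_metric_graph_rel_def)
    obtain a b c where iso: "is_weighted_iso
      (contract G (vanishing G x)) (contract_weight G w (vanishing G x))
      (contract G (vanishing G y)) (contract_weight G w (vanishing G y)) a b c"
      and b: "\<And>e. e \<in> ?E - vanishing G x \<Longrightarrow> y (b e) = x e"
      using xy metric_isomorphic_contract_iff [OF top] by (auto simp: same_metric_graph_rel_def)
    let ?b = "restrict b (?E - vanishing G x)"
    have "is_weighted_iso
      (contract G (vanishing G x)) (contract_weight G w (vanishing G x))
      (contract G (vanishing G y)) (contract_weight G w (vanishing G y)) a ?b c"
      by (rule is_weighted_iso_cong_edges [OF iso]) (simp add: contract_sel)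
    moreover have "b e \<in> ?E" if "e \<in> ?E - vanishing G x" for e
      using iso that by (auto simp: is_weighted_iso_def is_graph_iso_def bij_betw_def contract_sel)
    ultimately have "?b \<in> J (vanishing G x) (vanishing G y)"
      by (auto simp: J_def)
    moreover have "(x, y) \<in> F (vanishing G x) (vanishing G y) ?b"
      using top b by (simp add: F_def) (simp add: vanishing_def)
    ultimately show "(x, y) \<in> (\<Union>Q\<in>Pow ?E. \<Union>Q'\<in>Pow ?E. \<Union>b\<in>J Q Q'. F Q Q' b)"
      by (intro UN_I [of "vanishing G x"] UN_I [of "vanishing G y"] UN_I [of ?b])
         (simp_all only: PowI vanishing_subset)
  next
    fix x y assume "(x, y) \<in> (\<Union>Q\<in>Pow ?E. \<Union>Q'\<in>Pow ?E. \<Union>b\<in>J Q Q'. F Q Q' b)"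
    then obtain Q Q' b where Q: "Q \<subseteq> ?E" "Q' \<subseteq> ?E" and J: "b \<in> J Q Q'" and F: "(x, y) \<in> F Q Q' b"
      by (elim UN_E PowD [elim_format])
    from J have "?iso Q Q' b"
      by (simp add: J_def)
    then obtain a c where iso: "is_weighted_iso (contract G Q) (contract_weight G w Q)
          (contract G Q') (contract_weight G w Q') a b c"
      by (elim exE)
    from F have top: "x \<in> topspace ?X" "y \<in> topspace ?X"
      and van: "\<And>e. e \<in> Q \<Longrightarrow> x e = {0, \<infinity>}" "\<And>e. e \<in> Q' \<Longrightarrow> y e = {0, \<infinity>}"
      and b: "\<And>e. e \<in> ?E - Q \<Longrightarrow> y (b e) = x e"
      by (auto simp: F_def)
    have bE: "b ` (?E - Q) = ?E - Q'"
      using iso by (auto simp: is_weighted_iso_def is_graph_iso_def bij_betw_def contract_sel)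
    \<comment> \<open>The edges that vanish in addition to \<open>Q\<close>. As matched coordinates
      agree, \<open>b\<close> sends them exactly to the additional vanishing edges of
      \<open>y\<close>.\<close>
    define T where "T = vanishing G x - Q"
    have T: "T \<subseteq> ?E - Q"
      using vanishing_subset [of G x] by (auto simp: T_def)
    have Vx: "Q \<union> T = vanishing G x"
      using Q van by (auto simp: T_def vanishing_def)
    have "e \<in> b ` T" if e: "e \<in> vanishing G y" "e \<notin> Q'" for e
    proof -
      have "e \<in> ?E - Q'"
        using e vanishing_subset [of G y] by blast
      then obtain d where d: "d \<in> ?E - Q" "e = b d"
        unfolding bE [symmetric] by blast
      then have "d \<in> T"
        using b [OF d(1)] e by (auto simp: T_def vanishing_def)
      with d show ?thesis by blast
    qed
    moreover have "b d \<in> vanishing G y" if "d \<in> T" for d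
    proof -
      have "d \<in> ?E - Q" "x d = {0, \<infinity>}"
        using T that by (auto simp: T_def vanishing_def)
      then show ?thesis
        using b [of d] bE by (auto simp: vanishing_def)
    qed
    ultimately have Vy: "Q' \<union> b ` T = vanishing G y"
      using Q van by (auto simp: vanishing_def)
    obtain a' c' where "is_weighted_iso (contract G (vanishing G x)) (contract_weight G w (vanishing G x))
      (contract G (vanishing G y)) (contract_weight G w (vanishing G y)) a' b c'"
      using is_weighted_iso_contract_more [OF G Q(1) G Q(2) iso T] unfolding Vx Vy by blast
    moreover have "\<forall>e\<in>?E - vanishing G x. y (b e) = x e"
      using b Vx by blast
    ultimately show "(x, y) \<in> same_metric_graph_rel G w"
      unfolding same_metric_graph_rel_def
      using top metric_isomorphic_contract_iff [OF top, of w] by blast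
  qed
  have finJ: "finite (J Q Q')" for Q Q'
    using finite_PiE [of "?E - Q" "\<lambda>_. ?E"] finE by (auto simp: J_def)
  have "closedin ?P (F Q Q' b)" if "Q \<subseteq> ?E" "Q' \<subseteq> ?E" "b \<in> J Q Q'" for Q Q' b
  proof -
    have bE: "b e \<in> ?E" if "e \<in> ?E - Q" for e
      using \<open>b \<in> J Q Q'\<close> that by (auto simp: J_def)
    have fst: "continuous_map ?P closed_ray (\<lambda>z. fst z e)"
      and snd: "continuous_map ?P closed_ray (\<lambda>z. snd z e)" if "e \<in> ?E" for e
    proof -
      have "continuous_map ?X closed_ray (\<lambda>x. x e)"
        unfolding cone_closure_def using that by (rule continuous_map_product_projection)
      then show "continuous_map ?P closed_ray (\<lambda>z. fst z e)" "continuous_map ?P closed_ray (\<lambda>z. snd z e)"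
        using continuous_map_compose [OF continuous_map_fst, of ?X closed_ray "\<lambda>x. x e" ?X]
          continuous_map_compose [OF continuous_map_snd, of ?X closed_ray "\<lambda>x. x e" ?X]
        by (simp_all add: comp_def)
    qed
    have const: "continuous_map ?P closed_ray (\<lambda>z. {0, \<infinity>})"
      by (simp add: topspace_closed_ray)
    note eq = closedin_continuous_maps_eq [OF Hausdorff_space_closed_ray]
    show ?thesis
      unfolding F_def
      by (intro closedin_Int closedin_Collect_Ball eq fst snd const; use that bE in blast)
  qed
  then show ?thesis
    unfolding eq using finE finJ by (intro closedin_UN_finite) auto
qed

lemma Mtr_closure_topology:
  assumes G: "is_graph G"
  shows compact_space_Mtr_closure: "compact_space (Mtr_closure G w)"
    and Hausdorff_space_Mtr_closure: "Hausdorff_space (Mtr_closure G w)"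
    and closed_map_Mtr_closure:
      "closed_map (cone_closure G) (Mtr_closure G w) (\<lambda>x. same_metric_graph_rel G w `` {x})"
    and quotient_map_Mtr_closure:
      "quotient_map (cone_closure G) (Mtr_closure G w) (\<lambda>x. same_metric_graph_rel G w `` {x})"
  unfolding Mtr_closure_def
  by (intro compact_space_quotient_topology Hausdorff_space_quotient_topology closed_map_quotient_topology
      compact_space_cone_closure Hausdorff_space_cone_closure equiv_same_metric_graph_rel
      closedin_same_metric_graph_rel quotient_map_quotient_topology G)+

section \<open>Strata\<close>

lemma class_eq_iff:
  assumes "is_graph G" "x \<in> topspace (cone_closure G)" "y \<in> topspace (cone_closure G)"
  shows "same_metric_graph_rel G w `` {x} = same_metric_graph_rel G w `` {y} \<longleftrightarrow>
    metric_isomorphic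
      (contract G (vanishing G x)) (contract_weight G w (vanishing G x)) (edge_length x)
      (contract G (vanishing G y)) (contract_weight G w (vanishing G y)) (edge_length y)"
  unfolding eq_equiv_class_iff [OF equiv_same_metric_graph_rel [OF assms(1)] assms(2,3)]
  using assms(2,3) by (simp add: same_metric_graph_rel_def)

text \<open>An isomorphism preserves the number of remaining edges. This invariant separates a
  stratum from the smaller ones in its closure.\<close>

lemma class_eq_card_vanishing:
  assumes G: "is_graph G" and top: "x \<in> topspace (cone_closure G)" "y \<in> topspace (cone_closure G)"
    and eq: "same_metric_graph_rel G w `` {x} = same_metric_graph_rel G w `` {y}"
  shows "card (vanishing G x) = card (vanishing G y)"
proof -
  have "card (edges G - vanishing G x) = card (edges G - vanishing G y)"
    using eq card_edges_iso unfolding class_eq_iff [OF G top] metric_isomorphic_def contract_sel(2) [symmetric]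
    by blast
  moreover have "finite (vanishing G z)" "card (vanishing G z) \<le> card (edges G)" for z
    using finite_subset [OF vanishing_subset is_graph_finite_edges [OF G]]
      card_mono [OF is_graph_finite_edges [OF G] vanishing_subset] .
  ultimately show ?thesis
    using vanishing_subset [of G x] vanishing_subset [of G y] by (simp add: card_Diff_subset)
      (metis diff_diff_cancel)
qed

section \<open>Closures of the sets with prescribed vanishing edges\<close>

lemma vanishing_eq_PiE:
  assumes "Q \<subseteq> edges G"
  shows "{x \<in> topspace (cone_closure G). vanishing G x = Q} =
    (\<Pi>\<^sub>E e\<in>edges G. if e \<in> Q then {{0, \<infinity>}} else open_ray)"
proof -
  have "x e \<in> (if e \<in> Q then {{0, \<infinity>}} else open_ray) \<longleftrightarrow>
      x e \<in> insert {0, \<infinity>} open_ray \<and> (x e = {0, \<infinity>} \<longleftrightarrow> e \<in> Q)" for x :: "_ \<Rightarrow> ennreal set" and e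
    using infinity_notin_open_ray by auto
  moreover have "vanishing G x = Q \<longleftrightarrow> (\<forall>e\<in>edges G. x e = {0, \<infinity>} \<longleftrightarrow> e \<in> Q)" for x
    using assms by (auto simp: vanishing_def)
  ultimately show ?thesis
    by (simp only: topspace_cone_closure set_eq_iff mem_Collect_eq PiE_iff ball_conj_distrib conj_ac) iprover
qed

lemma vanishing_supset_PiE:
  assumes "Q \<subseteq> edges G"
  shows "{x \<in> topspace (cone_closure G). Q \<subseteq> vanishing G x} =
    (\<Pi>\<^sub>E e\<in>edges G. if e \<in> Q then {{0, \<infinity>}} else topspace closed_ray)"
proof -
  have "x e \<in> (if e \<in> Q then {{0, \<infinity>}} else topspace closed_ray) \<longleftrightarrow>
      x e \<in> insert {0, \<infinity>} open_ray \<and> (e \<in> Q \<longrightarrow> x e = {0, \<infinity>})" for x :: "_ \<Rightarrow> ennreal set" and e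
    by (auto simp: topspace_closed_ray)
  moreover have "Q \<subseteq> vanishing G x \<longleftrightarrow> (\<forall>e\<in>edges G. e \<in> Q \<longrightarrow> x e = {0, \<infinity>})" for x
    using assms by (auto simp: vanishing_def)
  ultimately show ?thesis
    by (simp only: topspace_cone_closure set_eq_iff mem_Collect_eq PiE_iff ball_conj_distrib conj_ac) iprover
qed

text \<open>The closure of a box is taken factor by factor. The glued point is closed and the open
  ray is dense, so exactly the coordinates outside \<open>Q\<close> become free.\<close>

lemma closure_of_vanishing_eq:
  assumes "Q \<subseteq> edges G"
  shows "cone_closure G closure_of {x \<in> topspace (cone_closure G). vanishing G x = Q} =
    {x \<in> topspace (cone_closure G). Q \<subseteq> vanishing G x}"
proof -
  have "closed_ray closure_of (if e \<in> Q then {{0, \<infinity>}} else open_ray) =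
      (if e \<in> Q then {{0, \<infinity>}} else topspace closed_ray)" for e
    using closedin_closed_ray_infinity by (simp add: closure_of_open_ray closure_of_closedin)
  then show ?thesis
    unfolding vanishing_eq_PiE [OF assms] vanishing_supset_PiE [OF assms]
    by (simp add: cone_closure_def closure_of_product_topology)
qed

lemma closedin_vanishing_supset:
  assumes "Q \<subseteq> edges G"
  shows "closedin (cone_closure G) {x \<in> topspace (cone_closure G). Q \<subseteq> vanishing G x}"
  using closedin_closure_of unfolding closure_of_vanishing_eq [OF assms, symmetric] .

text \<open>Closures commute with a map that is closed, for one inclusion, and continuous, for the
  other.\<close>

lemma closure_of_class_image:
  assumes G: "is_graph G" and Q: "Q \<subseteq> edges G"
  shows "Mtr_closure G w closure_of
      (\<lambda>x. same_metric_graph_rel G w `` {x}) ` {x \<in> topspace (cone_closure G). vanishing G x = Q} =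
    (\<lambda>x. same_metric_graph_rel G w `` {x}) ` {x \<in> topspace (cone_closure G). Q \<subseteq> vanishing G x}"
  unfolding closure_of_vanishing_eq [OF Q, symmetric]
proof (rule antisym)
  let ?q = "\<lambda>x. same_metric_graph_rel G w `` {x}"
    and ?L = "{x \<in> topspace (cone_closure G). vanishing G x = Q}"
  show "Mtr_closure G w closure_of ?q ` ?L \<subseteq> ?q ` (cone_closure G closure_of ?L)"
    by (rule closed_map_Mtr_closure [OF G, unfolded closed_map_closure_of_image,
          THEN conjunct2, rule_format]) (rule Collect_restrict)
  show "?q ` (cone_closure G closure_of ?L) \<subseteq> Mtr_closure G w closure_of ?q ` ?L"
    by (rule continuous_map_image_closure_subset
        [OF quotient_imp_continuous_map [OF quotient_map_Mtr_closure [OF G]]])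
qed

text \<open>A stratum is closed in the complement of finitely many closed sets, because contracting a
  further edge lowers the number of edges and hence cannot give an isomorphic graph.\<close>

lemma class_image_vanishing_eq:
  assumes G: "is_graph G" and Q: "Q \<subseteq> edges G"
  shows "(\<lambda>x. same_metric_graph_rel G w `` {x}) ` {x \<in> topspace (cone_closure G). vanishing G x = Q} =
    (topspace (Mtr_closure G w) - (\<Union>e\<in>edges G - Q. (\<lambda>x. same_metric_graph_rel G w `` {x}) `
        {x \<in> topspace (cone_closure G). insert e Q \<subseteq> vanishing G x})) \<inter>
    (\<lambda>x. same_metric_graph_rel G w `` {x}) ` {x \<in> topspace (cone_closure G). Q \<subseteq> vanishing G x}"
    (is "?q ` ?L = (?Y - (\<Union>e\<in>_. ?q ` ?K e)) \<inter> ?q ` ?K'")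
proof (intro equalityI subsetI)
  fix y assume "y \<in> ?q ` ?L"
  then obtain x where x: "x \<in> topspace (cone_closure G)" "vanishing G x = Q" "y = ?q x"
    by blast
  have "y \<in> ?Y"
    using x quotient_imp_surjective_map [OF quotient_map_Mtr_closure [OF G, of w]] by blast
  moreover have "y \<notin> ?q ` ?K e" if e: "e \<in> edges G - Q" for e
  proof
    assume "y \<in> ?q ` ?K e"
    then obtain x' where x': "x' \<in> topspace (cone_closure G)" "insert e Q \<subseteq> vanishing G x'" "y = ?q x'"
      by blast
    have "card Q < card (vanishing G x')"
      using x' e finite_subset [OF vanishing_subset is_graph_finite_edges [OF G]]
      by (intro psubset_card_mono) auto
    moreover have "card (vanishing G x) = card (vanishing G x')"
      using class_eq_card_vanishing [OF G x(1) x'(1), of w] x(3) x'(3) by simp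
    ultimately show False
      using x by simp
  qed
  moreover have "y \<in> ?q ` ?K'"
    using x by blast
  ultimately show "y \<in> (?Y - (\<Union>e\<in>edges G - Q. ?q ` ?K e)) \<inter> ?q ` ?K'"
    by blast
next
  fix y assume y: "y \<in> (?Y - (\<Union>e\<in>edges G - Q. ?q ` ?K e)) \<inter> ?q ` ?K'"
  then obtain x where x: "x \<in> topspace (cone_closure G)" "Q \<subseteq> vanishing G x" "y = ?q x"
    by blast
  have "e \<in> Q" if "e \<in> vanishing G x" for e
    using that y x vanishing_subset [of G x] by blast
  then show "y \<in> ?q ` ?L"
    using x by blast
qed

lemma locally_closed_class_image:
  assumes G: "is_graph G" and Q: "Q \<subseteq> edges G"
  shows "\<exists>U C. openin (Mtr_closure G w) U \<and> closedin (Mtr_closure G w) C \<and>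
    (\<lambda>x. same_metric_graph_rel G w `` {x}) ` {x \<in> topspace (cone_closure G). vanishing G x = Q} = U \<inter> C"
proof -
  let ?q = "\<lambda>x. same_metric_graph_rel G w `` {x}"
  have cl: "closedin (Mtr_closure G w) (?q ` {x \<in> topspace (cone_closure G). Q' \<subseteq> vanishing G x})"
    if "Q' \<subseteq> edges G" for Q'
    using closed_map_Mtr_closure [OF G, of w] closedin_vanishing_supset [OF that]
    unfolding closed_map_def by blast
  have "closedin (Mtr_closure G w)
      (\<Union>e\<in>edges G - Q. ?q ` {x \<in> topspace (cone_closure G). insert e Q \<subseteq> vanishing G x})"
    using is_graph_finite_edges [OF G] Q by (intro closedin_UN_finite cl) auto
  then show ?thesis
    using class_image_vanishing_eq [OF G Q, of w] cl [OF Q] by blast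
qed

section \<open>The stratum of a single contraction\<close>

lemma topspace_cone: "topspace (cone G) = (\<Pi>\<^sub>E e\<in>edges G. {0<..})"
  by (simp add: cone_def)

text \<open>In this form the orbit relation inherits symmetry and transitivity from metric
  isomorphism.\<close>

lemma aut_orbit_rel_eq:
  "aut_orbit_rel G w = {(x, y). x \<in> topspace (cone G) \<and> y \<in> topspace (cone G) \<and>
     metric_isomorphic G w x G w y}"
  by (auto simp: aut_orbit_rel_def Aut_def metric_isomorphic_def)

lemma equiv_aut_orbit_rel:
  assumes "is_graph G"
  shows "equiv (topspace (cone G)) (aut_orbit_rel G w)"
proof (rule equivI)
  show "sym (aut_orbit_rel G w)"
    unfolding aut_orbit_rel_eq using metric_isomorphic_sym [OF assms, of w _ G w] by (intro symI) blast
  show "trans (aut_orbit_rel G w)"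
    unfolding aut_orbit_rel_eq using metric_isomorphic_trans [of G w _ G w _ G w] by (intro transI) blast
qed (auto simp: aut_orbit_rel_eq metric_isomorphic_refl intro!: refl_onI)

text \<open>The inclusion of an open cone as the face of the closed cone where exactly
  \<open>Q\<close> vanishes; \<open>b\<close> translates the edges of \<open>G\<close> outside
  \<open>Q\<close> into those on which \<open>x\<close> is given.\<close>

definition include_cone ::
  "('v, 'e, 'l) graph \<Rightarrow> 'e set \<Rightarrow> ('e \<Rightarrow> 'e2) \<Rightarrow> ('e2 \<Rightarrow> real) \<Rightarrow> 'e \<Rightarrow> ennreal set" where
  "include_cone G Q b x = (\<lambda>e\<in>edges G. if e \<in> Q then {0, \<infinity>} else {ennreal (x (b e))})"

context
  fixes G :: "('v, 'e, 'l) graph" and w :: "'v \<Rightarrow> nat" and Q :: "'e set"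
    and G' :: "('v2, 'e2, 'l2) graph" and w' :: "'v2 \<Rightarrow> nat" and a b c
  assumes G: "is_graph G" and Q: "Q \<subseteq> edges G" and G': "is_graph G'"
    and iso: "is_weighted_iso (contract G Q) (contract_weight G w Q) G' w' a b c"
begin

lemma bij_betw_edges: "bij_betw b (edges G - Q) (edges G')"
  using iso by (simp add: is_weighted_iso_def is_graph_iso_def contract_sel)

text \<open>Coordinatewise this is the homeomorphism of the positive half line with the open ray,
  relabelled by \<open>b\<close>; the coordinates in \<open>Q\<close> are constant.\<close>

lemma homeomorphic_map_include_cone:
  "homeomorphic_map (cone G')
     (subtopology (cone_closure G) {x \<in> topspace (cone_closure G). vanishing G x = Q})
     (include_cone G Q b)"
proof -
  let ?L = "{x \<in> topspace (cone_closure G). vanishing G x = Q}"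
  let ?d = "inv_into (edges G - Q) b"
  \<comment> \<open>Reads the lengths back along the inverse of \<open>b\<close>; the restriction to
    \<open>edges G'\<close> makes the result a point of the product.\<close>
  let ?k = "\<lambda>y. \<lambda>e\<in>edges G'. edge_length y (?d e)"
  have bE: "b e \<in> edges G'" if "e \<in> edges G" "e \<notin> Q" for e
    using bij_betw_edges that by (auto simp: bij_betw_def)
  have dE: "?d e \<in> edges G - Q" "b (?d e) = e" if "e \<in> edges G'" for e
    using bij_betw_edges that by (metis bij_betw_def inv_into_into, metis bij_betw_inv_into_right)
  have db: "?d (b e) = e" if "e \<in> edges G" "e \<notin> Q" for e
    using bij_betw_inv_into_left [OF bij_betw_edges] that by simp
  have ray: "continuous_map (top_of_set {0<..}) (subtopology closed_ray open_ray) (\<lambda>t. {ennreal t})"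
      "continuous_map (subtopology closed_ray open_ray) (top_of_set {0<..}) (\<lambda>p. enn2real (the_elem p))"
    using homeomorphic_maps_open_ray by (auto simp: homeomorphic_maps_def)
  have inL: "include_cone G Q b x \<in> ?L" if "x \<in> topspace (cone G')" for x
  proof -
    have "x (b e) > 0" if "e \<in> edges G" "e \<notin> Q" for e
      using \<open>x \<in> topspace (cone G')\<close> bE [OF that] by (auto simp: topspace_cone)
    then show ?thesis
      unfolding vanishing_eq_PiE [OF Q] by (auto simp: include_cone_def open_ray_def)
  qed
  have L_ray: "y e \<in> open_ray" if "y \<in> ?L" "e \<in> edges G" "e \<notin> Q" for y e
    using that unfolding vanishing_eq_PiE [OF Q] by (auto simp: PiE_iff split: if_splits)
  have "continuous_map (cone G') closed_ray (\<lambda>x. include_cone G Q b x e)" if e: "e \<in> edges G" for e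
  proof (cases "e \<in> Q")
    case True
    then show ?thesis
      using e by (simp add: include_cone_def topspace_closed_ray)
  next
    case False
    have "continuous_map (cone G') (top_of_set {0<..}) (\<lambda>x. x (b e))"
      unfolding cone_def by (rule continuous_map_product_projection [OF bE [OF e False]])
    from continuous_map_compose [OF this continuous_map_into_fulltopology [OF ray(1)]] show ?thesis
      using e False by (simp add: include_cone_def comp_def)
  qed
  then have "continuous_map (cone G') (cone_closure G) (include_cone G Q b)"
    unfolding cone_closure_def continuous_map_componentwise
    by (auto simp: include_cone_def)
  then have j: "continuous_map (cone G') (subtopology (cone_closure G) ?L) (include_cone G Q b)"
    using inL by (auto intro: continuous_map_into_subtopology)
  have "continuous_map (subtopology (cone_closure G) ?L) (top_of_set {0<..}) (\<lambda>y. ?k y e)"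
    if e: "e \<in> edges G'" for e
  proof -
    have "continuous_map (subtopology (cone_closure G) ?L) closed_ray (\<lambda>y. y (?d e))"
      unfolding cone_closure_def using dE [OF e]
      by (intro continuous_map_from_subtopology continuous_map_product_projection) auto
    then have "continuous_map (subtopology (cone_closure G) ?L) (subtopology closed_ray open_ray) (\<lambda>y. y (?d e))"
      using L_ray dE [OF e] by (intro continuous_map_into_subtopology) auto
    from continuous_map_compose [OF this ray(2)] show ?thesis
      using e by (simp add: edge_length_def comp_def)
  qed
  then have k: "continuous_map (subtopology (cone_closure G) ?L) (cone G') ?k"
    unfolding cone_def continuous_map_componentwise by auto
  have "?k (include_cone G Q b x) = x" if "x \<in> topspace (cone G')" for x
  proof
    fix e
    show "?k (include_cone G Q b x) e = x e"
    proof (cases "e \<in> edges G'")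
      case True
      then have "x e > 0"
        using that by (auto simp: topspace_cone)
      then show ?thesis
        using dE [OF True] True by (simp add: edge_length_def include_cone_def)
    next
      case False
      then show ?thesis
        using that by (auto simp: topspace_cone PiE_iff extensional_def)
    qed
  qed
  moreover have "include_cone G Q b (?k y) = y" if y: "y \<in> ?L" for y
  proof
    fix e
    consider "e \<notin> edges G" | "e \<in> Q" "e \<in> edges G" | "e \<in> edges G" "e \<notin> Q" by blast
    then show "include_cone G Q b (?k y) e = y e"
    proof cases
      case 1
      then show ?thesis
        using y by (auto simp: include_cone_def topspace_cone_closure PiE_iff extensional_def)
    next
      case 2
      then show ?thesis
        using y by (auto simp: include_cone_def vanishing_def)
    next
      case 3
      then show ?thesis
        using y cone_closure_eq_edge_length [of y G e] bE [OF 3] db [OF 3]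
        by (simp add: include_cone_def)
    qed
  qed
  ultimately have "homeomorphic_maps (cone G') (subtopology (cone_closure G) ?L) (include_cone G Q b) ?k"
    using j k by (simp add: homeomorphic_maps_def)
  then show ?thesis
    by (simp add: homeomorphic_maps_map)
qed

lemma include_cone_in:
  assumes "x \<in> topspace (cone G')"
  shows "include_cone G Q b x \<in> topspace (cone_closure G)" "vanishing G (include_cone G Q b x) = Q"
  using homeomorphic_imp_surjective_map [OF homeomorphic_map_include_cone] assms by auto

lemma metric_isomorphic_include_cone:
  assumes "x \<in> topspace (cone G')"
  shows "metric_isomorphic (contract G Q) (contract_weight G w Q) (edge_length (include_cone G Q b x)) G' w' x"
proof -
  \<comment> \<open>\<open>ennreal\<close> sends negative numbers to 0, so recovering a length from
    its coordinate relies on its sign.\<close>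
  have "x (b e) > 0" if "e \<in> edges G - Q" for e
    using assms bij_betw_edges that by (auto simp: topspace_cone bij_betw_def)
  then have "\<forall>e\<in>edges (contract G Q). x (b e) = edge_length (include_cone G Q b x) e"
    by (simp add: contract_sel edge_length_def include_cone_def less_imp_le)
  then show ?thesis
    using iso unfolding metric_isomorphic_def by blast
qed

text \<open>Composing with metric isomorphisms makes the choice of representative in the orbit
  irrelevant. The stratum map is thus induced by \<open>include_cone\<close> followed by the
  quotient map.\<close>

lemma stratum_map_orbit:
  assumes x: "x \<in> topspace (cone G')"
  shows "stratum_map G w G' w' (aut_orbit_rel G' w' `` {x}) =
    same_metric_graph_rel G w `` {include_cone G Q b x}"
proof -
  note MI = metric_isomorphic_include_cone [OF x]
  note IM = metric_isomorphic_sym [OF is_graph_contract [OF G] MI]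
  have "(\<exists>x'\<in>aut_orbit_rel G' w' `` {x}. metric_isomorphic G' w' x' H v l) \<longleftrightarrow>
      metric_isomorphic (contract G Q) (contract_weight G w Q) (edge_length (include_cone G Q b x)) H v l"
    for H :: "('v set, 'e, 'l) graph" and v l
  proof
    assume "\<exists>x'\<in>aut_orbit_rel G' w' `` {x}. metric_isomorphic G' w' x' H v l"
    then obtain x' where "metric_isomorphic G' w' x G' w' x'" "metric_isomorphic G' w' x' H v l"
      by (auto simp: aut_orbit_rel_eq)
    then show "metric_isomorphic (contract G Q) (contract_weight G w Q)
        (edge_length (include_cone G Q b x)) H v l"
      using metric_isomorphic_trans [OF metric_isomorphic_trans [OF MI]] by blast
  next
    assume "metric_isomorphic (contract G Q) (contract_weight G w Q)
        (edge_length (include_cone G Q b x)) H v l"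
    then have "metric_isomorphic G' w' x H v l"
      by (rule metric_isomorphic_trans [OF IM])
    moreover have "x \<in> aut_orbit_rel G' w' `` {x}"
      using x by (simp add: aut_orbit_rel_eq metric_isomorphic_refl)
    ultimately show "\<exists>x'\<in>aut_orbit_rel G' w' `` {x}. metric_isomorphic G' w' x' H v l"
      by blast
  qed
  then show ?thesis
    using include_cone_in [OF x] unfolding stratum_map_def same_metric_graph_rel_def by auto
qed

lemma stratum_eq_class_image:
  "stratum G w G' w' =
    (\<lambda>x. same_metric_graph_rel G w `` {x}) ` {x \<in> topspace (cone_closure G). vanishing G x = Q}"
proof -
  have "stratum G w G' w' = (\<lambda>x. stratum_map G w G' w' (aut_orbit_rel G' w' `` {x})) ` topspace (cone G')"
    by (simp add: stratum_def Mtr_def quotient_eq_image image_image)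
  also have "\<dots> = (\<lambda>x. same_metric_graph_rel G w `` {x}) ` include_cone G Q b ` topspace (cone G')"
    unfolding image_image by (rule image_cong [OF refl stratum_map_orbit])
  also have "include_cone G Q b ` topspace (cone G') = {x \<in> topspace (cone_closure G). vanishing G x = Q}"
    using homeomorphic_imp_surjective_map [OF homeomorphic_map_include_cone] by auto
  finally show ?thesis .
qed

text \<open>An injective quotient map is a homeomorphism, and both \<open>Mtr G' w'\<close> and the
  stratum are quotients of the open cone of \<open>G'\<close>, with the same fibres.\<close>

lemma embedding_map_stratum_map:
  "embedding_map (Mtr G' w') (Mtr_closure G w) (stratum_map G w G' w')"
proof -
  let ?X = "cone_closure G" and ?Y = "Mtr_closure G w"
  let ?q = "\<lambda>x. same_metric_graph_rel G w `` {x}" and ?p = "\<lambda>x. aut_orbit_rel G' w' `` {x}"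
  let ?L = "{x \<in> topspace ?X. vanishing G x = Q}" and ?K = "{x \<in> topspace ?X. Q \<subseteq> vanishing G x}"
  let ?f = "stratum_map G w G' w'"
  have p: "quotient_map (cone G') (Mtr G' w') ?p"
    unfolding Mtr_def by (rule quotient_map_quotient_topology)
  have LY: "?q ` ?L \<subseteq> topspace ?Y"
    using quotient_imp_surjective_map [OF quotient_map_Mtr_closure [OF G, of w]] by blast
  \<comment> \<open>\<open>?K\<close> is closed, so the quotient map stays closed on it;
    \<open>?L\<close> itself is in general neither closed nor a union of fibres in
    \<open>?X\<close>.\<close>
  have "closed_map (subtopology ?X ?K) ?Y ?q"
    by (rule closed_map_from_subtopology [OF closed_map_Mtr_closure [OF G] closedin_vanishing_supset [OF Q]])
  moreover have "{x \<in> topspace (subtopology ?X ?K). ?q x \<in> ?q ` ?L} = ?L"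
  proof (intro equalityI subsetI)
    fix x assume "x \<in> {x \<in> topspace (subtopology ?X ?K). ?q x \<in> ?q ` ?L}"
    then obtain x' where x: "x \<in> topspace ?X" "Q \<subseteq> vanishing G x"
      and x': "x' \<in> topspace ?X" "vanishing G x' = Q" "?q x = ?q x'"
      by auto
    have "card (vanishing G x) = card Q"
      using class_eq_card_vanishing [OF G x(1) x'(1,3)] x'(2) by simp
    then have "vanishing G x = Q"
      using x(2) finite_subset [OF vanishing_subset is_graph_finite_edges [OF G], of x]
      by (metis card_subset_eq)
    with x show "x \<in> ?L" by simp
  qed auto
  ultimately have "closed_map (subtopology (subtopology ?X ?K) ?L) (subtopology ?Y (?q ` ?L)) ?q"
    by (rule closed_map_restriction)
  moreover have "?K \<inter> ?L = ?L"
    by auto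
  ultimately have "closed_map (subtopology ?X ?L) (subtopology ?Y (?q ` ?L)) ?q"
    by (simp only: subtopology_subtopology)
  moreover have "continuous_map (subtopology ?X ?L) (subtopology ?Y (?q ` ?L)) ?q"
    using quotient_imp_continuous_map [OF quotient_map_Mtr_closure [OF G]]
    by (intro continuous_map_into_subtopology continuous_map_from_subtopology) auto
  moreover have "?q ` topspace (subtopology ?X ?L) = topspace (subtopology ?Y (?q ` ?L))"
    using LY by auto
  ultimately have "quotient_map (subtopology ?X ?L) (subtopology ?Y (?q ` ?L)) ?q"
    by (intro continuous_closed_imp_quotient_map)
  then have "quotient_map (cone G') (subtopology ?Y (?q ` ?L)) (?q \<circ> include_cone G Q b)"
    using homeomorphic_map_include_cone unfolding homeomorphic_map_def by (blast intro: quotient_map_compose)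
  \<comment> \<open>The composite is the stratum map after the orbit map; as \<open>?p\<close> is a
    quotient map, it can be cancelled.\<close>
  then have "quotient_map (cone G') (subtopology ?Y (?q ` ?L)) (?f \<circ> ?p)"
    by (rule quotient_map_eq) (simp add: stratum_map_orbit)
  then have "quotient_map (Mtr G' w') (subtopology ?Y (?q ` ?L)) ?f"
    by (simp only: quotient_map_compose_eq [OF p])
  moreover have "inj_on ?f (topspace (Mtr G' w'))"
  proof -
    have "?p x = ?p y" if xy: "x \<in> topspace (cone G')" "y \<in> topspace (cone G')" and "?f (?p x) = ?f (?p y)" for x y
    proof -
      have *: "metric_isomorphic
          (contract G Q) (contract_weight G w Q) (edge_length (include_cone G Q b x))
          (contract G Q) (contract_weight G w Q) (edge_length (include_cone G Q b y))"
        using that(3) class_eq_iff [OF G include_cone_in(1) include_cone_in(1), OF xy]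
        by (simp add: stratum_map_orbit xy include_cone_in)
      note metric_isomorphic_sym [OF is_graph_contract [OF G] metric_isomorphic_include_cone [OF xy(1)]]
      \<comment> \<open>Going from \<open>G'\<close> to the contraction, across, and back gives an
        automorphism of \<open>(G', w')\<close> carrying \<open>x\<close> to
        \<open>y\<close>.\<close>
      from metric_isomorphic_trans [OF metric_isomorphic_trans [OF this *] metric_isomorphic_include_cone [OF xy(2)]]
      have "metric_isomorphic G' w' x G' w' y" .
      then show ?thesis
        using xy by (intro equiv_class_eq [OF equiv_aut_orbit_rel [OF G']]) (simp add: aut_orbit_rel_eq)
    qed
    then show ?thesis
      by (auto simp: inj_on_def Mtr_def quotient_eq_image)
  qed
  ultimately have "homeomorphic_map (Mtr G' w') (subtopology ?Y (?q ` ?L)) ?f"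
    by (simp add: homeomorphic_map_def)
  moreover have "?f ` topspace (Mtr G' w') = ?q ` ?L"
    using stratum_eq_class_image by (simp add: stratum_def)
  ultimately show ?thesis
    by (simp add: embedding_map_def)
qed

end

section \<open>Assembling the strata\<close>

lemma weighted_contractionE:
  assumes "weighted_contraction G' w' G w"
  obtains Q a b c where "Q \<subseteq> edges G" "is_graph G'"
    "is_weighted_iso (contract G Q) (contract_weight G w Q) G' w' a b c"
  \<comment> \<open>The definition starts the isomorphism at \<open>G'\<close>; inverting it makes
    the edge map start at edges of \<open>G\<close>, as \<open>include_cone\<close>
    requires.\<close>
  using assms is_weighted_iso_inv unfolding weighted_contraction_def weighted_isomorphic_def by metis

lemma stratum_eq_of_isomorphic:
  assumes G: "is_graph G" and Q: "Q \<subseteq> edges G" and G': "is_graph G'"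
    and iso: "weighted_isomorphic G' w' (contract G Q) (contract_weight G w Q)"
  shows "stratum G w G' w' =
    (\<lambda>x. same_metric_graph_rel G w `` {x}) ` {x \<in> topspace (cone_closure G). vanishing G x = Q}"
  using iso stratum_eq_class_image [OF G Q G' is_weighted_iso_inv [OF G']]
  unfolding weighted_isomorphic_def by blast

lemma vanishing_eq_nonempty:
  assumes "Q \<subseteq> edges G"
  shows "{x \<in> topspace (cone_closure G). vanishing G x = Q} \<noteq> {}"
proof -
  have "{ennreal 1} \<in> open_ray"
    unfolding open_ray_def by (rule imageI) simp
  then show ?thesis
    unfolding vanishing_eq_PiE [OF assms] PiE_eq_empty_iff by auto
qed

lemma stratification_Mtr_closure:
  fixes R :: "(('v2, 'e2, 'l2) graph \<times> ('v2 \<Rightarrow> nat)) set"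
  assumes G: "is_graph G" and R: "contraction_representatives G w R"
  shows "stratification (Mtr_closure G w) R (\<lambda>(G', w'). stratum G w G' w')"
proof -
  let ?X = "cone_closure G" and ?Y = "Mtr_closure G w" and ?q = "\<lambda>x. same_metric_graph_rel G w `` {x}"
  let ?L = "\<lambda>Q. {x \<in> topspace ?X. vanishing G x = Q}" and ?K = "\<lambda>Q. {x \<in> topspace ?X. Q \<subseteq> vanishing G x}"
  let ?T = "\<lambda>(G', w'). stratum G w G' w'"
  let ?rep = "\<lambda>H Q. weighted_isomorphic (fst H) (snd H) (contract G Q) (contract_weight G w Q)"
  have contr: "weighted_contraction (fst H) (snd H) G w" if "H \<in> R" for H
    using R that unfolding contraction_representatives_def by (cases H) auto
  have graph: "is_graph (fst H)" and ex: "\<exists>Q. Q \<subseteq> edges G \<and> ?rep H Q" if "H \<in> R" for H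
    using contr [OF that] by (auto simp: weighted_contraction_def)
  have uniq: "H = H'" if "H \<in> R" "H' \<in> R" "?rep H Q" "?rep H' Q" "Q \<subseteq> edges G" for H H' Q
    using R that unfolding contraction_representatives_def by blast
  have cover: "\<exists>H\<in>R. ?rep H Q" if "Q \<subseteq> edges G" for Q
    using R that unfolding contraction_representatives_def by blast
  have T: "?T H = ?q ` ?L Q" if "H \<in> R" "?rep H Q" "Q \<subseteq> edges G" for H Q
    using stratum_eq_of_isomorphic [OF G that(3) graph [OF that(1)] that(2)] by (simp add: case_prod_beta)
  \<comment> \<open>The metric graph of a point determines its stratum, whichever \<open>Q\<close>
    represents \<open>H\<close>. Disjointness follows, as two members of \<open>R\<close> sharing a
    point represent the same contraction.\<close>
  have rep_V: "?rep H (vanishing G x)"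
    if H: "H \<in> R" and x: "x \<in> topspace ?X" "?q x \<in> ?T H" for H x
  proof -
    obtain Q where Q: "Q \<subseteq> edges G" "?rep H Q"
      using ex [OF H] by blast
    then obtain x' where x': "x' \<in> topspace ?X" "vanishing G x' = Q" "?q x' = ?q x"
      using x(2) T [OF H Q(2,1)] by auto
    then obtain a b c where "is_weighted_iso (contract G Q) (contract_weight G w Q)
        (contract G (vanishing G x)) (contract_weight G w (vanishing G x)) a b c"
      using class_eq_iff [OF G x'(1) x(1), of w] unfolding metric_isomorphic_def by auto
    then show ?thesis
      using Q(2) is_weighted_iso_comp unfolding weighted_isomorphic_def by blast
  qed
  have surj: "topspace ?Y = ?q ` topspace ?X"
    using quotient_imp_surjective_map [OF quotient_map_Mtr_closure [OF G, of w]] by simp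
  have T_Y: "?T H \<subseteq> topspace ?Y" if H: "H \<in> R" for H
  proof -
    obtain Q where "Q \<subseteq> edges G" "?rep H Q"
      using ex [OF H] by blast
    then show ?thesis
      using T [OF H] surj by auto
  qed
  have meet: "H = H'" if H: "H \<in> R" "H' \<in> R" and y: "y \<in> ?T H" "y \<in> ?T H'" for H H' y
  proof -
    obtain x where "x \<in> topspace ?X" "y = ?q x"
      using T_Y [OF H(1)] y(1) surj by blast
    then show ?thesis
      using uniq [OF H rep_V [OF H(1)] rep_V [OF H(2)] vanishing_subset] y by blast
  qed
  have "finite R"
  proof -
    \<comment> \<open>One chosen edge set per member of \<open>R\<close> embeds \<open>R\<close>
      into the finite power set of the edges.\<close>
    define Q where "Q H = (SOME Q. Q \<subseteq> edges G \<and> ?rep H Q)"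
      for H :: "('v2, 'e2, 'l2) graph \<times> ('v2 \<Rightarrow> nat)"
    have Q: "Q H \<subseteq> edges G \<and> ?rep H (Q H)" if "H \<in> R" for H
      unfolding Q_def by (rule someI_ex [OF ex [OF that]])
    then have "inj_on Q R"
      by (intro inj_onI) (metis uniq)
    moreover have "Q ` R \<subseteq> Pow (edges G)"
      using Q by blast
    ultimately show ?thesis
      using is_graph_finite_edges [OF G] by (meson finite_Pow_iff inj_on_finite)
  qed
  moreover have "topspace ?Y = (\<Union>H\<in>R. ?T H)"
  proof
    show "(\<Union>H\<in>R. ?T H) \<subseteq> topspace ?Y"
      using T_Y by (rule UN_least)
    show "topspace ?Y \<subseteq> (\<Union>H\<in>R. ?T H)"
    proof
      fix y assume "y \<in> topspace ?Y"
      then obtain x where x: "x \<in> topspace ?X" "y = ?q x"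
        using surj by blast
      obtain H where "H \<in> R" "?rep H (vanishing G x)"
        using cover [OF vanishing_subset] by blast
      then show "y \<in> (\<Union>H\<in>R. ?T H)"
        using T [OF _ _ vanishing_subset] x by blast
    qed
  qed
  moreover have "disjoint_family_on ?T R"
    unfolding disjoint_family_on_def using meet by blast
  moreover have "?T H \<noteq> {} \<and> (\<exists>U C. openin ?Y U \<and> closedin ?Y C \<and> ?T H = U \<inter> C)" if H: "H \<in> R" for H
  proof -
    obtain Q where "Q \<subseteq> edges G" "?rep H Q"
      using ex [OF H] by blast
    then show ?thesis
      using vanishing_eq_nonempty locally_closed_class_image [OF G, of Q w] unfolding T [OF H \<open>?rep H Q\<close> \<open>Q \<subseteq> edges G\<close>]
      by blast
  qed
  moreover have "?T H \<subseteq> ?Y closure_of ?T H'"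
    if H: "H \<in> R" "H' \<in> R" and ne: "?T H \<inter> ?Y closure_of ?T H' \<noteq> {}" for H H'
  proof -
    obtain Q where Q: "Q \<subseteq> edges G" "?rep H' Q"
      using ex [OF H(2)] by blast
    have cl: "?Y closure_of ?T H' = ?q ` ?K Q"
      unfolding T [OF H(2) Q(2,1)] by (rule closure_of_class_image [OF G Q(1)])
    then obtain x where x: "x \<in> topspace ?X" "Q \<subseteq> vanishing G x" "?q x \<in> ?T H"
      using ne by auto
    \<comment> \<open>\<open>H\<close> is also represented by the vanishing set of \<open>x\<close>,
      which contains \<open>Q\<close>; this yields the frontier condition.\<close>
    have "?T H = ?q ` ?L (vanishing G x)"
      by (rule T [OF H(1) rep_V [OF H(1) x(1,3)] vanishing_subset])
    also have "\<dots> \<subseteq> ?q ` ?K Q"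
      using x(2) by auto
    finally show ?thesis
      unfolding cl .
  qed
  ultimately show ?thesis
    unfolding stratification_def by blast
qed

text \<open>Isomorphism classes are replaced by an arbitrary list \<open>R\<close> of
  representatives, over types of their own. The embedding clause says that each
  \<open>Mtr G' w'\<close> is identified with its stratum as a topological space, not just as a
  set.\<close>

theorem theorem1p1:
  fixes g n :: nat
    and S :: "'s topology" and \<A> \<C> :: "'s chart set" and ps :: "'s list"
    and G :: "('v, 'e, 'l) graph"
  assumes "2 - 2 * int g - int n < 0"
    and "pointed_riemann_surface g n S \<A> \<C> ps"
    and "regular_tropicalization S \<A> ps G"
  shows
    "((\<forall>(G' :: ('v2, 'e2, 'l2) graph) w'. weighted_contraction G' w' G (\<lambda>_. 0) \<longrightarrow>
         embedding_map (Mtr G' w') (Mtr_closure G (\<lambda>_. 0)) (stratum_map G (\<lambda>_. 0) G' w')) \<and>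
      (\<forall>R :: (('v2, 'e2, 'l2) graph \<times> ('v2 \<Rightarrow> nat)) set.
         contraction_representatives G (\<lambda>_. 0) R \<longrightarrow>
         stratification (Mtr_closure G (\<lambda>_. 0)) R (\<lambda>(G', w'). stratum G (\<lambda>_. 0) G' w')) \<and>
      openin (Mtr_closure G (\<lambda>_. 0)) (stratum G (\<lambda>_. 0) G (\<lambda>_. 0)) \<and>
      Mtr_closure G (\<lambda>_. 0) closure_of stratum G (\<lambda>_. 0) G (\<lambda>_. 0)
        = topspace (Mtr_closure G (\<lambda>_. 0))) \<and>
     compact_space (Mtr_closure G (\<lambda>_. 0)) \<and>
     Hausdorff_space (Mtr_closure G (\<lambda>_. 0))"
proof -
  have G: "is_graph G"
    using assms(3) by (simp add: regular_tropicalization_def)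
  let ?w = "\<lambda>_::'v. 0::nat"
  let ?q = "\<lambda>x. same_metric_graph_rel G ?w `` {x}"
  have emb: "embedding_map (Mtr G' w') (Mtr_closure G ?w) (stratum_map G ?w G' w')"
    if "weighted_contraction G' w' G ?w" for G' :: "('v2, 'e2, 'l2) graph" and w'
    using that by (rule weighted_contractionE) (rule embedding_map_stratum_map [OF G])
  have surj: "?q ` topspace (cone_closure G) = topspace (Mtr_closure G ?w)"
    by (rule quotient_imp_surjective_map [OF quotient_map_Mtr_closure [OF G]])
  \<comment> \<open>\<open>G\<close> is its own contraction along the empty set, so its stratum
    consists of the classes of points where no edge vanishes.\<close>
  have top: "stratum G ?w G ?w = ?q ` {x \<in> topspace (cone_closure G). vanishing G x = {}}"
    using is_weighted_iso_contract_empty [OF G, of ?w]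
    by (intro stratum_eq_of_isomorphic [OF G _ G]) (auto simp: weighted_isomorphic_def)
  have dense: "Mtr_closure G ?w closure_of stratum G ?w G ?w = topspace (Mtr_closure G ?w)"
    unfolding top closure_of_class_image [OF G empty_subsetI] using surj by simp
  \<comment> \<open>The complement of the top stratum consists of the classes at which some edge
    vanishes, a finite union of closed sets.\<close>
  have "closedin (Mtr_closure G ?w) (\<Union>e\<in>edges G - {}. ?q ` {x \<in> topspace (cone_closure G). insert e {} \<subseteq> vanishing G x})"
    using is_graph_finite_edges [OF G] closed_map_Mtr_closure [OF G, of ?w]
      closedin_vanishing_supset [of "insert _ {}" G] unfolding closed_map_def
    by (intro closedin_UN_finite) auto
  then have open_top: "openin (Mtr_closure G ?w) (stratum G ?w G ?w)"
    unfolding top class_image_vanishing_eq [OF G empty_subsetI] using surj by (intro openin_Int openin_diff) auto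
  show ?thesis
    using emb stratification_Mtr_closure [OF G, of ?w] open_top dense
      compact_space_Mtr_closure [OF G, of ?w] Hausdorff_space_Mtr_closure [OF G, of ?w]
    by blast
qed

end
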